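(* Let $H=H(x,y)$ be a real-valued function defined near the origin of $\mathbb{R}^2$, $H=H_2+H_*$, where $H_2=\pi(x^2+y^2)$ and $H_*=O(|x|+|y|)^3$. Put $z=\frac{1}{\sqrt2}(x+iy)$, $\overline z=\frac1{\sqrt2}(x-iy)$, so that $H_2=2\pi z\overline z$, and suppose that $$H_*=\sum_{\beta\in\mathbb{Z}_+^2,\ |\beta|\ge 3}H_\beta\, z^{\beta_1}\overline z^{\beta_2},$$ where the series converges in a neighborhood of the point $(z,\overline z)=(0,0)$. Then the Hamiltonian system $$\dot x=\partial H/\partial y,\qquad \dot y=-\partial H/\partial x$$ is (locally) isochronous if and only if $$\sum_{s=1}^{2d}\frac{(-1)^{s-1}(d+s)!}{s!\,(d+1)!}\,\Sigma_s^d=0\qquad\text{for all } d=1,2,\ldots$$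
   Context: Notation: $\mathbb{Z}_+=\{0,1,2,\ldots\}$; for $\beta=(\beta_1,\beta_2)\in\mathbb{Z}_+^2$, $|\beta|=\beta_1+\beta_2$. The system is called (locally) isochronous if all its solutions starting in some neighborhood of the origin are periodic with period one (i.e. the time-one map of the flow is the identity near the origin). For $d,k\ge 1$, $$\Sigma_k^d=\frac{1}{(2\pi)^k}\sum H_{\beta^{(1)}}\cdots H_{\beta^{(k)}},$$ where the sum is over all ordered $k$-tuples $(\beta^{(1)},\ldots,\beta^{(k)})$ with $\beta^{(j)}\in\mathbb{Z}_+^2$, $|\beta^{(j)}|\ge3$ and $\beta^{(1)}+\cdots+\beta^{(k)}=(d+k,d+k)$. (These conditions can be satisfied only if $k\le 2d$.) *)

theory Defs
  imports "HOL-Analysis.Analysis" "HOL-Library.Landau_Symbols"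
begin

definition zcoord :: "real \<Rightarrow> real \<Rightarrow> complex" where
  "zcoord x y = Complex x y / complex_of_real (sqrt 2)"

text \<open>
  A complete solution of \<open>x' = \<partial>H/\<partial>y\<close>, \<open>y' = - \<partial>H/\<partial>x\<close> in the domain \<open>U\<close> of \<open>H\<close>;
  values of \<open>H\<close> outside \<open>U\<close> are irrelevant when \<open>U\<close> is open.
\<close>
definition hamiltonian_solution ::
    "(real \<Rightarrow> real \<Rightarrow> real) \<Rightarrow> (real \<times> real) set \<Rightarrow> (real \<Rightarrow> real \<times> real) \<Rightarrow> bool" where
  "hamiltonian_solution H U \<gamma> \<longleftrightarrow>
     (\<forall>t. \<gamma> t \<in> U \<and>
        ((\<lambda>s. fst (\<gamma> s)) has_real_derivative deriv (\<lambda>y. H (fst (\<gamma> t)) y) (snd (\<gamma> t))) (at t) \<and>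
        ((\<lambda>s. snd (\<gamma> s)) has_real_derivative - deriv (\<lambda>x. H x (snd (\<gamma> t))) (fst (\<gamma> t))) (at t))"

text \<open>
  The existence clause prevents the periodicity clause from holding vacuously, e.g. when
  solutions starting near the origin leave \<open>U\<close> in finite time. One need not be the minimal period.
\<close>
definition locally_isochronous ::
    "(real \<Rightarrow> real \<Rightarrow> real) \<Rightarrow> (real \<times> real) set \<Rightarrow> bool" where
  "locally_isochronous H U \<longleftrightarrow>
     (\<exists>V. open V \<and> (0, 0) \<in> V \<and> V \<subseteq> U \<and>
        (\<forall>p\<in>V. \<exists>\<gamma>. hamiltonian_solution H U \<gamma> \<and> \<gamma> 0 = p) \<and>
        (\<forall>\<gamma>. hamiltonian_solution H U \<gamma> \<and> \<gamma> 0 \<in> V \<longrightarrow> (\<forall>t. \<gamma> (t + 1) = \<gamma> t)))"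

definition index_tuples :: "nat \<Rightarrow> nat \<Rightarrow> (nat \<times> nat) list set" where
  "index_tuples d k =
     {bs. length bs = k \<and> (\<forall>\<beta>\<in>set bs. fst \<beta> + snd \<beta> \<ge> 3) \<and> sum_list bs = (d + k, d + k)}"

text \<open>\<open>Sigma_coeff h d k\<close> is \<open>\<Sigma>\<^sub>k\<^sup>d\<close>, with \<open>h \<beta>\<close> in the role of \<open>H\<^sub>\<beta>\<close>.\<close>
definition Sigma_coeff :: "(nat \<times> nat \<Rightarrow> complex) \<Rightarrow> nat \<Rightarrow> nat \<Rightarrow> complex" where
  "Sigma_coeff h d k =
     (\<Sum>bs\<in>index_tuples d k. prod_list (map h bs)) / complex_of_real ((2 * pi) ^ k)"

text \<open>The sum defining \<open>Sigma_coeff\<close> is finite, and empty for \<open>k > 2 * d\<close>.\<close>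

lemma fst_snd_sum_list:
  fixes bs :: "(nat \<times> nat) list"
  shows "fst (sum_list bs) = sum_list (map fst bs)" "snd (sum_list bs) = sum_list (map snd bs)"
  by (induction bs) auto

lemma finite_index_tuples: "finite (index_tuples d k)"
proof (rule finite_subset)
  show "index_tuples d k \<subseteq> {bs. set bs \<subseteq> {..d + k} \<times> {..d + k} \<and> length bs = k}"
  proof (clarsimp simp: index_tuples_def)
    fix bs :: "(nat \<times> nat) list" and a b
    assume "sum_list bs = (d + length bs, d + length bs)" and ab: "(a, b) \<in> set bs"
    then have s: "sum_list (map fst bs) = d + length bs" "sum_list (map snd bs) = d + length bs"
      using fst_snd_sum_list[of bs] by auto
    have "a \<in> set (map fst bs)" "b \<in> set (map snd bs)"
      using ab by force+
    then show "a \<le> d + length bs \<and> b \<le> d + length bs"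
      using member_le_sum_list[of a "map fst bs"] member_le_sum_list[of b "map snd bs"] s by simp
  qed
  show "finite {bs. set bs \<subseteq> {..d + k} \<times> {..d + k} \<and> length bs = k}"
    by (intro finite_lists_length_eq) auto
qed

lemma index_tuples_empty:
  assumes "k > 2 * d"
  shows "index_tuples d k = {}"
proof -
  have ge: "\<forall>\<beta>\<in>set bs. fst \<beta> + snd \<beta> \<ge> 3 \<Longrightarrow>
      fst (sum_list bs) + snd (sum_list bs) \<ge> 3 * length bs" for bs :: "(nat \<times> nat) list"
    by (induction bs) auto
  show ?thesis
    using assms by (auto simp: index_tuples_def dest!: ge)
qed

end

(*
  In the coordinates z = r cis \<theta>, w = r cis (- \<theta>) the Hamiltonian is 2 \<pi> P with
  P(r, \<theta>) = r\<^sup>2 + G(z, w), where G is the normalized series of H_*. Near the origin the orbits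
  are the closed level curves P = e, and integrating 1 / \<theta>' along such a curve gives its
  period T(e) as the mean over \<theta> of 2 R / P'(R, \<theta>), where R = R(e, \<theta>) > 0 is the root of
  P(r, \<theta>) = e and P' is the derivative in r. Extended to complex r, the equation P(r, \<theta>) = e has
  exactly one further small root, namely - R(e, \<theta> + \<pi>). Hence the residue theorem turns T(e)
  into the mean of r\<^sup>2 / (P - e) over the torus |r| = \<sigma>, \<theta> real, which is a power series in e
  whose d-th coefficient is the torus mean of r\<^sup>2 / P^(d+1). Expanding (1 + G / r\<^sup>2)^(-d-1) by the
  binomial series and using that only the monomials z^n w^n = r^(2n) survive averaging,
  this coefficient is 1 for d = 0 and - (d + 1) times the sum of the theorem for d \<ge> 1.
  Finally, orbits have period one iff T(e) = 1, since T(e) \<rightarrow> 1 as e \<rightarrow> 0 rules out T(e) = 1/n.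
*)
theory Submission
  imports Defs "HOL-Complex_Analysis.Complex_Analysis"
begin

section \<open>Power series without terms of order less than three\<close>

text \<open>In a single direction \<theta> the radius \<open>R e \<theta>\<close> is a series in the
  square root of e, so the period integral cannot be expanded in e as it stands. Pairing opposite
  directions removes the half-integral powers, and moving the integration to a circle in the complex
  r-plane that does not depend on e removes the implicit function. The constants
  \<open>\<delta>\<close>, \<open>e0\<close>, \<open>\<sigma>\<close> are tuned to this: the cubic
  part must be a small relative perturbation of \<open>r\<^sup>2\<close>, and the circle must
  enclose both roots while \<open>P\<close> on it stays larger than every admissible energy by a
  fixed factor. On the dynamical side a solution is an arbitrary differentiable curve in
  \<open>U\<close>, whereas \<open>H\<close> is controlled only near the origin. Conservation of
  energy therefore has to confine the orbit before polar coordinates apply. Afterwards the system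
  separates into one scalar equation for the angle, and a primitive of \<open>q e / pi\<close>
  together with its inverse does the work of the existence and uniqueness theorems for differential
  equations.\<close>

locale cubic_series =
  fixes g :: "nat \<times> nat \<Rightarrow> complex" and \<rho> :: real
  assumes rho_pos: "\<rho> > 0"
    and summable_g: "(\<lambda>\<beta>. norm (g \<beta>) * \<rho> ^ (fst \<beta> + snd \<beta>)) summable_on {\<beta>. fst \<beta> + snd \<beta> \<ge> 3}"
begin

text \<open>The double series is enumerated by \<^const>\<open>prod_decode\<close>, since term-by-term differentiation
  in the library is for series over \<^typ>\<open>nat\<close>.\<close>

definition deg :: "nat \<Rightarrow> nat" where
  "deg n = fst (prod_decode n) + snd (prod_decode n)"

definition cf :: "nat \<Rightarrow> complex" where
  "cf n = (if deg n \<ge> 3 then g (prod_decode n) else 0)"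

definition majorant :: "nat \<Rightarrow> real" where
  "majorant n = norm (cf n) * \<rho> ^ deg n"

definition mon :: "nat \<Rightarrow> complex \<Rightarrow> complex \<Rightarrow> complex" where
  "mon n z w = cf n * z ^ fst (prod_decode n) * w ^ snd (prod_decode n)"

definition mon_z :: "nat \<Rightarrow> complex \<Rightarrow> complex \<Rightarrow> complex" where
  "mon_z n z w = cf n * (of_nat (fst (prod_decode n)) * z ^ (fst (prod_decode n) - 1)) * w ^ snd (prod_decode n)"

definition mon_w :: "nat \<Rightarrow> complex \<Rightarrow> complex \<Rightarrow> complex" where
  "mon_w n z w = cf n * z ^ fst (prod_decode n) * (of_nat (snd (prod_decode n)) * w ^ (snd (prod_decode n) - 1))"

definition G :: "complex \<Rightarrow> complex \<Rightarrow> complex" where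
  "G z w = (\<Sum>n. mon n z w)"

definition G1 :: "complex \<Rightarrow> complex \<Rightarrow> complex" where
  "G1 z w = (\<Sum>n. mon_z n z w)"

definition G2 :: "complex \<Rightarrow> complex \<Rightarrow> complex" where
  "G2 z w = (\<Sum>n. mon_w n z w)"

text \<open>The factor \<open>8\<close> absorbs differentiation: \<open>l * (\<rho> / 2) ^ (l - 3) \<le> 8 / \<rho> ^ 3 * \<rho> ^ l\<close>.\<close>

definition C :: real where
  "C = 8 / \<rho> ^ 3 * (\<Sum>n. majorant n)"

lemma majorant_nonneg: "majorant n \<ge> 0"
  using rho_pos by (simp add: majorant_def)

lemma has_sum_prod_decode:
  "(f has_sum s) {\<beta>. fst \<beta> + snd \<beta> \<ge> (3::nat)} \<longleftrightarrow>
    ((\<lambda>n. if deg n \<ge> 3 then f (prod_decode n) else 0) has_sum s) UNIV"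
    (is "?L \<longleftrightarrow> ?R")
proof -
  have "?L \<longleftrightarrow> ((\<lambda>\<beta>. if fst \<beta> + snd \<beta> \<ge> 3 then f \<beta> else 0) has_sum s) UNIV"
    by (rule has_sum_cong_neutral) auto
  also have "\<dots> \<longleftrightarrow> ?R"
    using has_sum_reindex_bij_betw[OF bij_prod_decode, of "\<lambda>\<beta>. if fst \<beta> + snd \<beta> \<ge> 3 then f \<beta> else 0" s]
    by (simp add: deg_def)
  finally show ?thesis .
qed

lemma summable_majorant: "summable majorant"
proof -
  obtain s where "((\<lambda>\<beta>. norm (g \<beta>) * \<rho> ^ (fst \<beta> + snd \<beta>)) has_sum s) {\<beta>. fst \<beta> + snd \<beta> \<ge> 3}"
    using summable_g by (auto simp: summable_on_def)
  then have "((\<lambda>n. if deg n \<ge> 3 then norm (g (prod_decode n)) * \<rho> ^ deg n else 0) has_sum s) UNIV"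
    unfolding has_sum_prod_decode by (simp only: deg_def)
  then have "(majorant has_sum s) UNIV"
    by (rule has_sum_cong[THEN iffD1, rotated]) (simp add: majorant_def cf_def)
  then show ?thesis
    using has_sum_imp_sums sums_summable by blast
qed

lemma C_nonneg: "C \<ge> 0"
  using rho_pos majorant_nonneg by (simp add: C_def suminf_nonneg summable_majorant)

lemma monomial_bound:
  fixes z w :: complex
  assumes "norm z \<le> m" "norm w \<le> m"
  shows "norm (z ^ i * w ^ j) \<le> m ^ (i + j)"
  unfolding norm_mult norm_power power_add
  using assms order_trans[OF norm_ge_zero assms(1)] by (intro mult_mono power_mono) auto

text \<open>Three factors \<open>m\<close> are kept and the remaining ones are enlarged to \<rho>,
  which leaves third order in \<open>m\<close>. The constant \<open>1 / \<rho> ^ 3\<close> is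
  weakened by the factor 8 so that one \<open>C\<close> serves the series and its
  derivatives.\<close>

lemma mon_bound:
  assumes "norm z \<le> m" "norm w \<le> m" "m \<le> \<rho> / 2"
  shows "norm (mon n z w) \<le> 8 / \<rho> ^ 3 * m ^ 3 * majorant n"
proof (cases "deg n \<ge> 3")
  case True
  then obtain k where k: "deg n = 3 + k"
    using le_Suc_ex by blast
  have m: "m \<ge> 0"
    using assms(1) norm_ge_zero order_trans by blast
  have "norm (mon n z w) \<le> norm (cf n) * m ^ (3 + k)"
    using monomial_bound[OF assms(1,2), of "fst (prod_decode n)" "snd (prod_decode n)"] k
    unfolding mon_def deg_def by (simp add: norm_mult mult_left_mono mult.assoc)
  also have "\<dots> \<le> norm (cf n) * (m ^ 3 * \<rho> ^ k)"
    unfolding power_add using m assms(3) rho_pos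
    by (intro mult_left_mono power_mono) auto
  also have "\<dots> = 1 / \<rho> ^ 3 * m ^ 3 * majorant n"
    using rho_pos by (simp add: majorant_def k power_add)
  also have "\<dots> \<le> 8 / \<rho> ^ 3 * m ^ 3 * majorant n"
    using rho_pos majorant_nonneg[of n] m by (intro mult_right_mono) (auto simp: divide_simps)
  finally show ?thesis .
next
  case False
  then show ?thesis
    using majorant_nonneg[of n] by (simp add: mon_def cf_def majorant_def)
qed

text \<open>One estimate for both partial derivatives: \<open>l\<close> is the exponent brought
  down, crudely at most \<open>2 ^ deg n\<close>. The halves in \<open>(\<rho> / 2) ^ k\<close>
  cancel this power down to \<open>2 ^ 3\<close>, the 8 in \<open>C\<close>.\<close>

lemma deriv_mon_bound:
  fixes z w :: complex
  assumes "norm z \<le> m" "norm w \<le> m" "m \<le> \<rho> / 2" "l \<le> deg n" "i + j = deg n - 1"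
  shows "norm (cf n * (of_nat l * (z ^ i * w ^ j))) \<le> 8 / \<rho> ^ 3 * m\<^sup>2 * majorant n"
proof (cases "deg n \<ge> 3")
  case True
  then obtain k where k: "deg n = 3 + k"
    using le_Suc_ex by blast
  have m: "m \<ge> 0"
    using assms(1) norm_ge_zero order_trans by blast
  have "norm (cf n * (of_nat l * (z ^ i * w ^ j))) = norm (cf n) * (real l * norm (z ^ i * w ^ j))"
    by (simp add: norm_mult)
  also have "\<dots> \<le> norm (cf n) * (2 ^ deg n * m ^ (2 + k))"
  proof (intro mult_left_mono mult_mono)
    show "real l \<le> 2 ^ deg n"
      using assms(4) of_nat_less_two_power[of "deg n", where 'a = real]
      by (meson less_imp_le of_nat_mono order_trans)
    show "norm (z ^ i * w ^ j) \<le> m ^ (2 + k)"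
      using monomial_bound[OF assms(1,2), of i j] assms(5) k by simp
  qed (use m in auto)
  also have "\<dots> \<le> norm (cf n) * (2 ^ deg n * (m\<^sup>2 * (\<rho> / 2) ^ k))"
    unfolding power_add using m assms(3) by (intro mult_left_mono power_mono) auto
  also have "\<dots> = 8 / \<rho> ^ 3 * m\<^sup>2 * majorant n"
    using rho_pos by (simp add: majorant_def k power_add power_divide)
  finally show ?thesis .
next
  case False
  then show ?thesis
    using majorant_nonneg[of n] by (simp add: cf_def majorant_def)
qed

lemma mon_z_bound:
  assumes "norm z \<le> m" "norm w \<le> m" "m \<le> \<rho> / 2"
  shows "norm (mon_z n z w) \<le> 8 / \<rho> ^ 3 * m\<^sup>2 * majorant n"
\<comment> \<open>The exponent \<open>i - 1\<close> truncates at \<open>i = 0\<close>, where the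
  degree count of \<open>deriv_mon_bound\<close> fails but the factor \<open>of_nat 0\<close> kills
  the term.\<close>
proof (cases "fst (prod_decode n)")
  case 0
  then show ?thesis
    using majorant_nonneg[of n] rho_pos by (simp add: mon_z_def)
next
  case (Suc i)
  then show ?thesis
    using deriv_mon_bound[OF assms, of "fst (prod_decode n)" n "fst (prod_decode n) - 1" "snd (prod_decode n)"]
    by (simp add: mon_z_def deg_def mult_ac)
qed

lemma mon_w_bound:
  assumes "norm z \<le> m" "norm w \<le> m" "m \<le> \<rho> / 2"
  shows "norm (mon_w n z w) \<le> 8 / \<rho> ^ 3 * m\<^sup>2 * majorant n"
proof (cases "snd (prod_decode n)")
  case 0
  then show ?thesis
    using majorant_nonneg[of n] rho_pos by (simp add: mon_w_def)
next
  case (Suc i)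
  then show ?thesis
    using deriv_mon_bound[OF assms, of "snd (prod_decode n)" n "fst (prod_decode n)" "snd (prod_decode n) - 1"]
    by (simp add: mon_w_def deg_def mult_ac)
qed

lemma suminf_majorant_bound:
  assumes "\<And>n. norm (f n :: complex) \<le> 8 / \<rho> ^ 3 * a * majorant n"
  shows "summable (\<lambda>n. norm (f n))" "norm (\<Sum>n. f n) \<le> C * a"
proof -
  have s: "summable (\<lambda>n. 8 / \<rho> ^ 3 * a * majorant n)"
    by (intro summable_mult summable_majorant)
  show sn: "summable (\<lambda>n. norm (f n))"
    by (rule summable_comparison_test[OF _ s]) (use assms in auto)
  have "norm (\<Sum>n. f n) \<le> (\<Sum>n. norm (f n))"
    by (rule summable_norm[OF sn])
  also have "\<dots> \<le> (\<Sum>n. 8 / \<rho> ^ 3 * a * majorant n)"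
    by (rule suminf_le[OF _ sn s]) (rule assms)
  also have "\<dots> = C * a"
    unfolding C_def by (subst suminf_mult) (auto simp: summable_majorant)
  finally show "norm (\<Sum>n. f n) \<le> C * a" .
qed

lemma G_bound:
  assumes "norm z \<le> m" "norm w \<le> m" "m \<le> \<rho> / 2"
  shows "norm (G z w) \<le> C * m ^ 3" "norm (G1 z w) \<le> C * m\<^sup>2" "norm (G2 z w) \<le> C * m\<^sup>2"
  using suminf_majorant_bound(2)[OF mon_bound[OF assms]]
    suminf_majorant_bound(2)[OF mon_z_bound[OF assms]] suminf_majorant_bound(2)[OF mon_w_bound[OF assms]]
  by (simp_all add: G_def G1_def G2_def)

lemma G_has_sum:
  assumes "norm z \<le> \<rho> / 2" "norm w \<le> \<rho> / 2"
  shows "((\<lambda>\<beta>. g \<beta> * z ^ fst \<beta> * w ^ snd \<beta>) has_sum G z w) {\<beta>. fst \<beta> + snd \<beta> \<ge> 3}"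
proof -
  have s: "summable (\<lambda>n. norm (mon n z w))"
    using suminf_majorant_bound(1)[OF mon_bound[OF assms order_refl]] .
  then have "(\<lambda>n. mon n z w) sums G z w"
    unfolding G_def by (rule summable_sums[OF summable_norm_cancel])
  then have "((\<lambda>n. mon n z w) has_sum G z w) UNIV"
    using norm_summable_imp_has_sum[OF s] by simp
  moreover have "mon n z w = (if deg n \<ge> 3 then g (prod_decode n) * z ^ fst (prod_decode n) * w ^ snd (prod_decode n) else 0)" for n
    unfolding mon_def cf_def by simp
  ultimately show ?thesis
    unfolding has_sum_prod_decode by simp
qed

abbreviation bidisc :: "(complex \<times> complex) set" where
  "bidisc \<equiv> cball 0 (\<rho> / 2) \<times> cball 0 (\<rho> / 2)"

section \<open>Uniform convergence and termwise differentiation\<close>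

lemma uniform_limit_mon_z_mon_w:
  "uniform_limit bidisc (\<lambda>n p. \<Sum>i<n. mon_z i (fst p) (snd p)) (\<lambda>p. G1 (fst p) (snd p)) sequentially"
  "uniform_limit bidisc (\<lambda>n p. \<Sum>i<n. mon_w i (fst p) (snd p)) (\<lambda>p. G2 (fst p) (snd p)) sequentially"
proof -
  have s: "summable (\<lambda>n. 8 / \<rho> ^ 3 * (\<rho> / 2)\<^sup>2 * majorant n)"
    by (intro summable_mult summable_majorant)
  show "uniform_limit bidisc (\<lambda>n p. \<Sum>i<n. mon_z i (fst p) (snd p)) (\<lambda>p. G1 (fst p) (snd p)) sequentially"
    unfolding G1_def by (rule Weierstrass_m_test[OF _ s], rule mon_z_bound) auto
  show "uniform_limit bidisc (\<lambda>n p. \<Sum>i<n. mon_w i (fst p) (snd p)) (\<lambda>p. G2 (fst p) (snd p)) sequentially"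
    unfolding G2_def by (rule Weierstrass_m_test[OF _ s], rule mon_w_bound) auto
qed

lemma continuous_on_G12:
  "continuous_on bidisc (\<lambda>p. G1 (fst p) (snd p))"
  "continuous_on bidisc (\<lambda>p. G2 (fst p) (snd p))"
proof -
  have "continuous_on bidisc (\<lambda>p. \<Sum>i<n. mon_z i (fst p) (snd p))"
    "continuous_on bidisc (\<lambda>p. \<Sum>i<n. mon_w i (fst p) (snd p))" for n
    unfolding mon_z_def mon_w_def by (intro continuous_intros)+
  then show "continuous_on bidisc (\<lambda>p. G1 (fst p) (snd p))"
    "continuous_on bidisc (\<lambda>p. G2 (fst p) (snd p))"
    using uniform_limit_theorem[OF _ uniform_limit_mon_z_mon_w(1)]
      uniform_limit_theorem[OF _ uniform_limit_mon_z_mon_w(2)] by simp_all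
qed

text \<open>Joint differentiability in (z, w), rather than in each variable, is what permits the
  chain rule along (r cis \<theta>, r cis (- \<theta>)) and along (z, cnj z). The partial sums of
  the differentials converge uniformly because each of the two partial derivatives contributes at
  most \<open>e / 2 * norm h\<close>.\<close>

lemma G_has_derivative_within:
  assumes "p \<in> bidisc"
  shows "((\<lambda>p. G (fst p) (snd p)) has_derivative
    (\<lambda>h. G1 (fst p) (snd p) * fst h + G2 (fst p) (snd p) * snd h)) (at p within bidisc)"
proof -
  let ?G' = "\<lambda>p h. G1 (fst p) (snd p) * fst h + G2 (fst p) (snd p) * snd h"
  have "\<exists>F. \<forall>p\<in>bidisc. (\<lambda>n. mon n (fst p) (snd p)) sums F p \<and> (F has_derivative ?G' p) (at p within bidisc)"
  proof (rule has_derivative_series)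
    show "convex bidisc"
      by (intro convex_Times convex_cball)
    show "((\<lambda>p. mon n (fst p) (snd p)) has_derivative
        (\<lambda>h. mon_z n (fst p) (snd p) * fst h + mon_w n (fst p) (snd p) * snd h)) (at p within bidisc)" for n p
    proof -
      let ?i = "fst (prod_decode n)" and ?j = "snd (prod_decode n)"
      have "((\<lambda>p. cf n * fst p ^ ?i * snd p ^ ?j) has_derivative
          (\<lambda>h. cf n * fst p ^ ?i * (of_nat ?j * snd h * snd p ^ (?j - 1))
            + cf n * (of_nat ?i * fst h * fst p ^ (?i - 1)) * snd p ^ ?j)) (at p within bidisc)"
        by (intro has_derivative_mult has_derivative_mult_right has_derivative_power
            has_derivative_fst has_derivative_snd has_derivative_ident)
      then show ?thesis
        unfolding mon_def mon_z_def mon_w_def by (simp add: mult_ac add_ac)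
    qed
    show "(0, 0) \<in> bidisc"
      using rho_pos by auto
    show "(\<lambda>n. mon n (fst (0, 0)) (snd (0, 0))) sums G 0 0"
      unfolding G_def
      using suminf_majorant_bound(1)[OF mon_bound[of 0 0 0]] rho_pos
      by (simp add: summable_sums summable_norm_cancel)
    fix e :: real assume "e > 0"
    then have e: "e / 2 > 0"
      by simp
    show "\<forall>\<^sub>F n in sequentially. \<forall>p\<in>bidisc. \<forall>h.
        norm ((\<Sum>i<n. mon_z i (fst p) (snd p) * fst h + mon_w i (fst p) (snd p) * snd h) - ?G' p h) \<le> e * norm h"
      using uniform_limitD[OF uniform_limit_mon_z_mon_w(1) e] uniform_limitD[OF uniform_limit_mon_z_mon_w(2) e]
    proof eventually_elim
      case (elim n)
      show ?case
      proof (intro ballI allI)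
        fix p h assume p: "p \<in> bidisc"
        have "norm ((\<Sum>i<n. mon_z i (fst p) (snd p) * fst h + mon_w i (fst p) (snd p) * snd h) - ?G' p h)
            = norm (((\<Sum>i<n. mon_z i (fst p) (snd p)) - G1 (fst p) (snd p)) * fst h
                + ((\<Sum>i<n. mon_w i (fst p) (snd p)) - G2 (fst p) (snd p)) * snd h)"
          by (simp add: sum.distrib sum_distrib_left algebra_simps)
        also have "\<dots> \<le> e / 2 * norm h + e / 2 * norm h"
        proof (rule norm_triangle_mono)
          show "norm (((\<Sum>i<n. mon_z i (fst p) (snd p)) - G1 (fst p) (snd p)) * fst h) \<le> e / 2 * norm h"
            unfolding norm_mult
            using elim(1)[rule_format, OF p] \<open>e > 0\<close> norm_fst_le[of "fst h" "snd h"]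
            by (intro mult_mono) (simp_all add: dist_norm)
          show "norm (((\<Sum>i<n. mon_w i (fst p) (snd p)) - G2 (fst p) (snd p)) * snd h) \<le> e / 2 * norm h"
            unfolding norm_mult
            using elim(2)[rule_format, OF p] \<open>e > 0\<close> norm_snd_le[of "snd h" "fst h"]
            by (intro mult_mono) (simp_all add: dist_norm)
        qed
        finally show "norm ((\<Sum>i<n. mon_z i (fst p) (snd p) * fst h + mon_w i (fst p) (snd p) * snd h) - ?G' p h)
            \<le> e * norm h"
          by simp
      qed
    qed
  qed
  then obtain F where F: "\<And>p. p \<in> bidisc \<Longrightarrow> (\<lambda>n. mon n (fst p) (snd p)) sums F p"
    "\<And>p. p \<in> bidisc \<Longrightarrow> (F has_derivative ?G' p) (at p within bidisc)"
    by blast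
  have "G (fst q) (snd q) = F q" if "q \<in> bidisc" for q
    unfolding G_def using F(1)[OF that] by (rule sums_unique[symmetric])
  then show ?thesis
    using F(2)[OF assms] assms has_derivative_transform[of p bidisc "\<lambda>p. G (fst p) (snd p)" F]
    by blast
qed

lemma G_has_derivative:
  assumes "norm z < \<rho> / 2" "norm w < \<rho> / 2"
  shows "((\<lambda>p. G (fst p) (snd p)) has_derivative
    (\<lambda>h. G1 z w * fst h + G2 z w * snd h)) (at (z, w))"
proof -
  have "ball 0 (\<rho> / 2) \<times> ball 0 (\<rho> / 2) \<subseteq> interior bidisc"
    by (intro interior_maximal Sigma_mono open_Times open_ball ball_subset_cball)
  moreover have "(z, w) \<in> ball 0 (\<rho> / 2) \<times> ball 0 (\<rho> / 2)"
    using assms by simp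
  ultimately have *: "(z, w) \<in> interior bidisc"
    by blast
  from G_has_derivative_within[OF subsetD[OF interior_subset *]] show ?thesis
    unfolding at_within_interior[OF *] fst_conv snd_conv .
qed

lemma continuous_on_G: "continuous_on bidisc (\<lambda>p. G (fst p) (snd p))"
  by (rule has_derivative_continuous_on[OF G_has_derivative_within])

end

section \<open>Polar form and roots\<close>

text \<open>Reality of \<open>H\<close> is expressed by the values of \<open>G\<close> on the plane
  \<open>w = cnj z\<close>; off this plane \<open>G\<close> is genuinely complex.\<close>

locale real_cubic_series = cubic_series +
  assumes G_real: "norm z < \<rho> / 2 \<Longrightarrow> Im (G z (cnj z)) = 0"
begin

text \<open>The first entry stays strictly inside the disc where \<open>G\<close> is differentiable.
  The second gives \<open>C * \<delta> \<le> 1 / 8\<close>, so that the cubic part is at most an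
  eighth of the quadratic one; \<open>C + 1\<close> avoids dividing by \<open>C = 0\<close>.\<close>

definition \<delta> :: real where
  "\<delta> = min (\<rho> / 4) (1 / (8 * (C + 1)))"

definition P :: "complex \<Rightarrow> real \<Rightarrow> complex" where
  "P r \<theta> = r\<^sup>2 + G (r * cis \<theta>) (r * cis (- \<theta>))"

definition P' :: "complex \<Rightarrow> real \<Rightarrow> complex" where
  "P' r \<theta> = 2 * r + (cis \<theta> * G1 (r * cis \<theta>) (r * cis (- \<theta>)) + cis (- \<theta>) * G2 (r * cis \<theta>) (r * cis (- \<theta>)))"

lemma delta_pos: "\<delta> > 0" and delta_less_rho: "\<delta> < \<rho> / 2"
  and C_delta: "C * \<delta> \<le> 1 / 8"
proof -
  show "\<delta> > 0" "\<delta> < \<rho> / 2"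
    using rho_pos C_nonneg by (auto simp: \<delta>_def)
  have "C * \<delta> \<le> C * (1 / (8 * (C + 1)))"
    using C_nonneg by (intro mult_left_mono) (auto simp: \<delta>_def)
  also have "\<dots> \<le> 1 / 8"
    using C_nonneg by (simp add: divide_simps)
  finally show "C * \<delta> \<le> 1 / 8" .
qed

lemma G_comp_has_derivative:
  assumes "norm (f x) < \<rho> / 2" "norm (k x) < \<rho> / 2"
    and "(f has_derivative f') (at x within S)" "(k has_derivative k') (at x within S)"
  shows "((\<lambda>x. G (f x) (k x)) has_derivative
    (\<lambda>h. G1 (f x) (k x) * f' h + G2 (f x) (k x) * k' h)) (at x within S)"
proof -
  have 1: "((\<lambda>x. (f x, k x)) has_derivative (\<lambda>h. (f' h, k' h))) (at x within S)"
    by (rule has_derivative_Pair[OF assms(3,4)])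
  show ?thesis
    using has_derivative_compose[OF 1 G_has_derivative[OF assms(1,2)]] by simp
qed

lemma P_minus_square_has_derivative:
  assumes "norm r < \<rho> / 2"
  shows "((\<lambda>r. P r \<theta> - r\<^sup>2) has_field_derivative P' r \<theta> - 2 * r) (at r within S)"
proof -
  have 1: "((\<lambda>r. r * cis \<theta>) has_derivative (\<lambda>h. h * cis \<theta>)) (at r within S)" for \<theta>
    by (intro derivative_intros)
  have "((\<lambda>r. G (r * cis \<theta>) (r * cis (- \<theta>))) has_derivative
      (\<lambda>h. G1 (r * cis \<theta>) (r * cis (- \<theta>)) * (h * cis \<theta>) + G2 (r * cis \<theta>) (r * cis (- \<theta>)) * (h * cis (- \<theta>))))
      (at r within S)"
    by (rule G_comp_has_derivative[OF _ _ 1 1]) (use assms in \<open>simp_all add: norm_mult\<close>)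
  moreover have "(\<lambda>h. G1 (r * cis \<theta>) (r * cis (- \<theta>)) * (h * cis \<theta>) + G2 (r * cis \<theta>) (r * cis (- \<theta>)) * (h * cis (- \<theta>)))
      = (*) (P' r \<theta> - 2 * r)"
    by (rule ext) (simp add: P'_def algebra_simps)
  ultimately show ?thesis
    by (simp add: has_field_derivative_def P_def)
qed

lemma P_has_derivative:
  assumes "norm r < \<rho> / 2"
  shows "((\<lambda>r. P r \<theta>) has_field_derivative P' r \<theta>) (at r within S)"
proof -
  have "((\<lambda>r. (P r \<theta> - r\<^sup>2) + r\<^sup>2) has_field_derivative (P' r \<theta> - 2 * r) + 2 * r) (at r within S)"
    by (rule DERIV_add[OF P_minus_square_has_derivative[OF assms]])
      (rule derivative_eq_intros refl | simp)+
  then show ?thesis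
    by simp
qed

lemma P_bounds_general:
  assumes "norm r \<le> m" "m \<le> \<rho> / 2"
  shows "norm (P r \<theta> - r\<^sup>2) \<le> C * m ^ 3" "norm (P' r \<theta> - 2 * r) \<le> 2 * C * m\<^sup>2"
proof -
  have n: "norm (r * cis \<theta>) \<le> m" "norm (r * cis (- \<theta>)) \<le> m"
    using assms by (simp_all add: norm_mult)
  show "norm (P r \<theta> - r\<^sup>2) \<le> C * m ^ 3"
    using G_bound(1)[OF n assms(2)] by (simp add: P_def)
  have "norm (P' r \<theta> - 2 * r) \<le> C * m\<^sup>2 + C * m\<^sup>2"
    unfolding P'_def add_diff_cancel_left'
    using G_bound(2,3)[OF n assms(2)] by (intro norm_triangle_mono) (simp_all add: norm_mult)
  then show "norm (P' r \<theta> - 2 * r) \<le> 2 * C * m\<^sup>2"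
    by simp
qed

lemma P_bounds:
  assumes "norm r \<le> \<delta>"
  shows "norm (P r \<theta> - r\<^sup>2) \<le> (norm r)\<^sup>2 / 8" "norm (P' r \<theta> - 2 * r) \<le> norm r / 4"
proof -
  have Cr: "C * norm r \<le> 1 / 8"
    using mult_left_mono[OF assms C_nonneg] C_delta by linarith
  note b = P_bounds_general[OF order_refl order_trans[OF assms less_imp_le[OF delta_less_rho]]]
  have "C * norm r ^ 3 = C * norm r * (norm r)\<^sup>2"
    by (simp add: power3_eq_cube power2_eq_square)
  also have "\<dots> \<le> 1 / 8 * (norm r)\<^sup>2"
    by (rule mult_right_mono[OF Cr]) simp
  finally show "norm (P r \<theta> - r\<^sup>2) \<le> (norm r)\<^sup>2 / 8"
    using b(1)[of \<theta>] by simp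
  have "2 * C * (norm r)\<^sup>2 = 2 * (C * norm r * norm r)"
    by (simp add: power2_eq_square)
  also have "\<dots> \<le> 2 * (1 / 8 * norm r)"
    by (intro mult_left_mono mult_right_mono[OF Cr]) simp_all
  finally show "norm (P' r \<theta> - 2 * r) \<le> norm r / 4"
    using b(2)[of \<theta>] by simp
qed

lemma norm_P_bounds:
  assumes "norm r \<le> \<delta>"
  shows "norm (P r \<theta>) \<ge> 7 / 8 * (norm r)\<^sup>2" "norm (P r \<theta>) \<le> 9 / 8 * (norm r)\<^sup>2"
  using P_bounds(1)[OF assms, of \<theta>] norm_triangle_ineq2[of "r\<^sup>2" "P r \<theta>"]
    norm_triangle_ineq2[of "P r \<theta>" "r\<^sup>2"]
  by (simp_all add: norm_power norm_minus_commute)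

text \<open>Both parameter pairs describe the same point (z, w). Hence a positive root in the
  direction \<open>\<theta> + pi\<close> is a negative root in the direction \<theta>.\<close>

lemma P_minus: "P (- r) \<theta> = P r (\<theta> + pi)" and P'_minus: "P' (- r) \<theta> = - P' r (\<theta> + pi)"
proof -
  have "cis (\<theta> + pi) = - cis \<theta>" "cis (- (\<theta> + pi)) = - cis (- \<theta>)"
    by (simp_all add: complex_eq_iff)
  then show "P (- r) \<theta> = P r (\<theta> + pi)" "P' (- r) \<theta> = - P' r (\<theta> + pi)"
    unfolding P_def P'_def by simp_all
qed

lemma P_periodic: "P r (\<theta> + 2 * pi) = P r \<theta>" and P'_periodic: "P' r (\<theta> + 2 * pi) = P' r \<theta>"
proof -
  have *: "cis (\<theta> + 2 * pi) = cis \<theta>"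
    by (simp add: complex_eq_iff)
  moreover have "cis (- (\<theta> + 2 * pi)) = cis (- \<theta>)"
    unfolding cis_cnj[symmetric] * ..
  ultimately show "P r (\<theta> + 2 * pi) = P r \<theta>" "P' r (\<theta> + 2 * pi) = P' r \<theta>"
    unfolding P_def P'_def by simp_all
qed

section \<open>Reality on the plane \<open>w = cnj z\<close>\<close>

lemma Im_P: "\<bar>r\<bar> < \<rho> / 2 \<Longrightarrow> Im (P (of_real r) \<theta>) = 0"
  using G_real[of "of_real r * cis \<theta>"] by (simp add: P_def norm_mult cis_cnj flip: of_real_power)

text \<open>The imaginary part of \<open>G z (cnj z)\<close> vanishes identically, hence so does its
  real derivative. The directions \<open>1\<close> and \<open>\<i>\<close> give the imaginary and
  the real part of the claim.\<close>

lemma G2_cnj: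
  assumes "norm z < \<rho> / 2"
  shows "G2 z (cnj z) = cnj (G1 z (cnj z))"
proof -
  have cnj: "(cnj has_derivative cnj) (at z)"
    by (rule bounded_linear_imp_has_derivative[OF bounded_linear_cnj])
  have "((\<lambda>z. G z (cnj z)) has_derivative (\<lambda>h. G1 z (cnj z) * h + G2 z (cnj z) * cnj h)) (at z)"
    by (rule G_comp_has_derivative[OF _ _ has_derivative_ident cnj]) (use assms in simp_all)
  then have D: "((\<lambda>z. Im (G z (cnj z))) has_derivative (\<lambda>h. Im (G1 z (cnj z) * h + G2 z (cnj z) * cnj h))) (at z)"
    by (rule has_derivative_Im)
  have "((\<lambda>z. Im (G z (cnj z))) has_derivative (\<lambda>h. 0)) (at z)"
    by (rule has_derivative_transform_within_open[OF has_derivative_const[of 0], of "ball 0 (\<rho> / 2)"])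
      (use assms G_real in auto)
  then have "(\<lambda>h. Im (G1 z (cnj z) * h + G2 z (cnj z) * cnj h)) = (\<lambda>h. 0)"
    by (rule has_derivative_unique[OF D])
  then have "Im (G1 z (cnj z) * h + G2 z (cnj z) * cnj h) = 0" for h
    by (rule fun_cong)
  from this[of 1] this[of \<i>] show ?thesis
    by (simp add: complex_eq_iff)
qed

text \<open>The derivative of \<open>z * w + G z w\<close> in \<open>w\<close> on the real plane \<open>w = cnj z\<close>.\<close>

definition hgrad :: "complex \<Rightarrow> complex" where
  "hgrad z = z + G2 z (cnj z)"

text \<open>The two chain-rule terms are conjugate by \<open>G2_cnj\<close>. This ties the radial
  derivative of the energy to \<open>hgrad\<close>, and so later to the angular speed of the
  flow.\<close>

lemma P'_real:
  assumes "\<bar>r\<bar> < \<rho> / 2"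
  shows "P' (of_real r) \<theta> = of_real (2 * Re (cis (- \<theta>) * hgrad (of_real r * cis \<theta>)))"
proof -
  have *: "cnj (of_real r * cis \<theta>) = of_real r * cis (- \<theta>)"
    by (simp add: cis_cnj)
  have "G2 (of_real r * cis \<theta>) (of_real r * cis (- \<theta>)) = cnj (G1 (of_real r * cis \<theta>) (of_real r * cis (- \<theta>)))"
    using G2_cnj[of "of_real r * cis \<theta>"] assms unfolding * by (simp add: norm_mult)
  then have "P' (of_real r) \<theta> = of_real (2 * r) + (cis \<theta> * G1 (of_real r * cis \<theta>) (of_real r * cis (- \<theta>))
      + cnj (cis \<theta> * G1 (of_real r * cis \<theta>) (of_real r * cis (- \<theta>))))"
    and "cis (- \<theta>) * hgrad (of_real r * cis \<theta>) = cis (- \<theta>) * cis \<theta> * of_real r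
      + cnj (cis \<theta> * G1 (of_real r * cis \<theta>) (of_real r * cis (- \<theta>)))"
    unfolding P'_def hgrad_def * by (simp_all add: cis_cnj algebra_simps)
  then show ?thesis
    unfolding complex_add_cnj cis_mult by simp
qed

section \<open>The real radial function and the roots of \<open>P r \<theta> = e\<close>\<close>

definition p :: "real \<Rightarrow> real \<Rightarrow> real" where
  "p r \<theta> = Re (P (of_real r) \<theta>)"

definition p' :: "real \<Rightarrow> real \<Rightarrow> real" where
  "p' r \<theta> = Re (P' (of_real r) \<theta>)"

lemma of_real_p: "\<bar>r\<bar> < \<rho> / 2 \<Longrightarrow> of_real (p r \<theta>) = P (of_real r) \<theta>"
  by (simp add: complex_eq_iff p_def Im_P)

lemma of_real_p': "\<bar>r\<bar> < \<rho> / 2 \<Longrightarrow> of_real (p' r \<theta>) = P' (of_real r) \<theta>"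
  by (simp add: p'_def P'_real)

lemma p_bounds:
  assumes "0 \<le> r" "r \<le> \<delta>"
  shows "7 / 8 * r\<^sup>2 \<le> p r \<theta>" "p r \<theta> \<le> 9 / 8 * r\<^sup>2" "7 / 4 * r \<le> p' r \<theta>" "p' r \<theta> \<le> 9 / 4 * r"
proof -
  have n: "norm (of_real r :: complex) \<le> \<delta>"
    using assms by simp
  have "\<bar>p r \<theta> - r\<^sup>2\<bar> \<le> r\<^sup>2 / 8"
    using order_trans[OF abs_Re_le_cmod P_bounds(1)[OF n, of \<theta>]] by (simp add: p_def flip: of_real_power)
  then show "7 / 8 * r\<^sup>2 \<le> p r \<theta>" "p r \<theta> \<le> 9 / 8 * r\<^sup>2"
    unfolding abs_le_iff by linarith+
  have "\<bar>p' r \<theta> - 2 * r\<bar> \<le> r / 4"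
    using order_trans[OF abs_Re_le_cmod P_bounds(2)[OF n, of \<theta>]] assms by (simp add: p'_def)
  then show "7 / 4 * r \<le> p' r \<theta>" "p' r \<theta> \<le> 9 / 4 * r"
    unfolding abs_le_iff by linarith+
qed

lemma p_has_derivative:
  assumes "\<bar>r\<bar> < \<rho> / 2"
  shows "((\<lambda>r. p r \<theta>) has_real_derivative p' r \<theta>) (at r within S)"
proof -
  have 1: "((\<lambda>r. of_real r :: complex) has_derivative of_real) (at r within S)"
    by (rule bounded_linear_imp_has_derivative[OF bounded_linear_of_real])
  have 2: "((\<lambda>r. P r \<theta>) has_derivative (*) (P' (of_real r) \<theta>)) (at (of_real r))"
    using P_has_derivative[of "of_real r"] assms by (simp add: has_field_derivative_def)
  have "((\<lambda>r. p r \<theta>) has_derivative (\<lambda>h. Re (P' (of_real r) \<theta> * of_real h))) (at r within S)"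
    unfolding p_def by (rule has_derivative_Re[OF has_derivative_compose[OF 1 2]])
  then show ?thesis
    by (simp add: has_field_derivative_def p'_def mult_commute_abs)
qed

text \<open>At radius \<delta> the energy is at least \<open>7 / 8 * \<delta>\<^sup>2\<close>, so a
  factor below \<open>7 / 8\<close> would give the roots; \<open>1 / 4\<close> also leaves room for
  a circle between the roots and \<delta>.\<close>

definition e0 :: real where
  "e0 = \<delta>\<^sup>2 / 4"

lemma e0_pos: "e0 > 0"
  using delta_pos by (simp add: e0_def)

lemma p_strict_mono:
  assumes "0 \<le> r" "r < s" "s \<le> \<delta>"
  shows "p r \<theta> < p s \<theta>"
proof (rule DERIV_pos_imp_increasing_open[OF assms(2)])
  fix x assume "r < x" "x < s"
  then have "((\<lambda>r. p r \<theta>) has_real_derivative p' x \<theta>) (at x)" "p' x \<theta> > 0"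
    using p_has_derivative[of x] p_bounds(3)[of x \<theta>] delta_less_rho assms by auto
  then show "\<exists>y. ((\<lambda>r. p r \<theta>) has_real_derivative y) (at x) \<and> y > 0"
    by blast
next
  show "continuous_on {r..s} (\<lambda>r. p r \<theta>)"
    by (rule DERIV_continuous_on, rule p_has_derivative) (use assms delta_less_rho in auto)
qed

lemma ex1_root:
  assumes "0 < e" "e < e0"
  shows "\<exists>!r. 0 < r \<and> r < \<delta> \<and> p r \<theta> = e"
proof -
  have "\<exists>r\<ge>0. r \<le> \<delta> \<and> p r \<theta> = e"
  proof (rule IVT')
    show "p 0 \<theta> \<le> e"
      using p_bounds(2)[of 0 \<theta>] delta_pos assms by simp
    show "e \<le> p \<delta> \<theta>"
      using p_bounds(1)[of \<delta> \<theta>] delta_pos assms by (simp add: e0_def)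
    show "continuous_on {0..\<delta>} (\<lambda>r. p r \<theta>)"
      by (rule DERIV_continuous_on, rule p_has_derivative) (use delta_less_rho in auto)
  qed (use delta_pos in simp)
  then obtain r where r: "0 \<le> r" "r \<le> \<delta>" "p r \<theta> = e"
    by blast
  have "r \<noteq> 0" "r \<noteq> \<delta>"
    using p_bounds(2)[of 0 \<theta>] p_bounds(1)[of \<delta> \<theta>] delta_pos assms r by (auto simp: e0_def)
  with r have "0 < r" "r < \<delta>" "p r \<theta> = e"
    by auto
  moreover have "s = r" if "0 < s" "s < \<delta>" "p s \<theta> = e" for s
    using p_strict_mono[of s r \<theta>] p_strict_mono[of r s \<theta>] that calculation by linarith
  ultimately show ?thesis
    by blast
qed

definition R :: "real \<Rightarrow> real \<Rightarrow> real" where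
  "R e \<theta> = (THE r. 0 < r \<and> r < \<delta> \<and> p r \<theta> = e)"

lemma R:
  assumes "0 < e" "e < e0"
  shows "0 < R e \<theta>" "R e \<theta> < \<delta>" "p (R e \<theta>) \<theta> = e"
  using theI'[OF ex1_root[OF assms, of \<theta>]] unfolding R_def by auto

lemma R_eqI:
  assumes "0 < r" "r < \<delta>" "p r \<theta> = e" "0 < e" "e < e0"
  shows "R e \<theta> = r"
  using ex1_root[OF assms(4,5), of \<theta>] R[OF assms(4,5), of \<theta>] assms(1-3) by blast

lemma R_periodic: "R e (\<theta> + 2 * pi) = R e \<theta>"
  by (simp add: R_def p_def P_periodic)

lemma R_bounds:
  assumes "0 < e" "e < e0"
  shows "8 / 9 * e \<le> (R e \<theta>)\<^sup>2" "(R e \<theta>)\<^sup>2 \<le> 8 / 7 * e"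
  using p_bounds(1,2)[of "R e \<theta>" \<theta>] R[OF assms, of \<theta>] by auto

text \<open>A substitute for Rouche's theorem: two distinct roots on the same level nearly cancel
  each other, which leaves no room for a third one.\<close>

lemma two_roots_nearly_opposite:
  assumes "norm r \<le> \<delta>" "norm s \<le> \<delta>" "P r \<theta> = of_real e" "P s \<theta> = of_real e" "r \<noteq> s"
    and "e > 0"
  shows "norm (r + s) \<le> norm s / 2"
proof -
  define m where "m = max (norm r) (norm s)"
  have m: "m \<le> \<delta>" "0 \<le> m"
    using assms by (auto simp: m_def le_max_iff_disj)
  have "norm ((P r \<theta> - r\<^sup>2) - (P s \<theta> - s\<^sup>2)) \<le> 2 * C * m\<^sup>2 * norm (r - s)"
  proof (rule field_differentiable_bound[of "cball 0 m"])
    show "((\<lambda>r. P r \<theta> - r\<^sup>2) has_field_derivative P' z \<theta> - 2 * z) (at z within cball 0 m)"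
      if "z \<in> cball 0 m" for z
      using that m delta_less_rho by (intro P_minus_square_has_derivative) auto
    show "norm (P' z \<theta> - 2 * z) \<le> 2 * C * m\<^sup>2" if "z \<in> cball 0 m" for z
      using that m delta_less_rho by (intro P_bounds_general) auto
  qed (auto simp: m_def)
  \<comment> \<open>On a common level the cubic parts differ by \<open>- (r\<^sup>2 - s\<^sup>2)\<close>, so \<open>r - s\<close> cancels.\<close>
  also have "(P r \<theta> - r\<^sup>2) - (P s \<theta> - s\<^sup>2) = - ((r + s) * (r - s))"
    using assms by (simp add: power2_eq_square algebra_simps)
  finally have "norm (r + s) * norm (r - s) \<le> 2 * C * m\<^sup>2 * norm (r - s)"
    by (simp add: norm_mult)
  then have "norm (r + s) \<le> 2 * C * m\<^sup>2"
    using \<open>r \<noteq> s\<close> by simp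
  also have "\<dots> \<le> 2 * (C * \<delta>) * m"
    using mult_left_mono[OF m(1), of "2 * C * m"] m(2) C_nonneg by (simp add: power2_eq_square mult_ac)
  also have "\<dots> \<le> 2 * (1 / 8) * m"
    using C_delta m by (intro mult_right_mono mult_left_mono) auto
  finally have 1: "norm (r + s) \<le> m / 4"
    by simp
  \<comment> \<open>All roots have comparable size, their squared norms being close to
    \<open>e\<close>. This turns the bound by \<open>m\<close> into one by \<open>norm s\<close>
    alone.\<close>
  have "7 / 8 * (norm r)\<^sup>2 \<le> 9 / 8 * (norm s)\<^sup>2"
    using norm_P_bounds(1)[OF assms(1), of \<theta>] norm_P_bounds(2)[OF assms(2), of \<theta>] assms by simp
  then have "(norm r)\<^sup>2 \<le> (2 * norm s)\<^sup>2"
    using zero_le_power2[of "norm s"] unfolding power_mult_distrib power2_eq_square[of "2::real"] by linarith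
  then have "norm r \<le> 2 * norm s"
    by (rule power2_le_imp_le) simp
  then have "m \<le> 2 * norm s"
    by (simp add: m_def)
  with 1 show ?thesis
    by simp
qed

text \<open>A third root would be close both to \<open>- R e \<theta>\<close> and to
  \<open>R e (\<theta> + pi)\<close>, so its real part would be negative and positive at
  once.\<close>

lemma P_roots:
  assumes "0 < e" "e < e0" "norm r \<le> \<delta>" "P r \<theta> = of_real e"
  shows "r = of_real (R e \<theta>) \<or> r = - of_real (R e (\<theta> + pi))"
proof (rule ccontr)
  assume no: "\<not> ?thesis"
  have R': "P (of_real (R e \<theta>)) \<theta> = of_real e" for \<theta>
    using R[OF assms(1,2), of \<theta>] delta_less_rho of_real_p[of "R e \<theta>" \<theta>] by simp
  have n: "norm (of_real (R e \<theta>) :: complex) \<le> \<delta>" "R e \<theta> > 0" for \<theta>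
    using R[OF assms(1,2), of \<theta>] by auto
  have "norm (r + of_real (R e \<theta>)) \<le> norm (of_real (R e \<theta>) :: complex) / 2"
    using two_roots_nearly_opposite[OF assms(3) n(1) assms(4) R'] no assms by simp
  then have "\<bar>Re r + R e \<theta>\<bar> \<le> R e \<theta> / 2"
    using abs_Re_le_cmod[of "r + of_real (R e \<theta>)"] n(2)[of \<theta>] by simp
  moreover have "norm (r + (- of_real (R e (\<theta> + pi)))) \<le> norm (- of_real (R e (\<theta> + pi)) :: complex) / 2"
  proof (rule two_roots_nearly_opposite[OF assms(3)])
    show "P (- of_real (R e (\<theta> + pi))) \<theta> = of_real e"
      by (simp only: P_minus R')
  qed (use assms no n in auto)
  then have "\<bar>Re r - R e (\<theta> + pi)\<bar> \<le> R e (\<theta> + pi) / 2"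
    using abs_Re_le_cmod[of "r + (- of_real (R e (\<theta> + pi)))"] n(2)[of "\<theta> + pi"] by simp
  ultimately show False
    using n(2)[of \<theta>] n(2)[of "\<theta> + pi"] by (auto simp: abs_le_iff)
qed

lemma P_R: "0 < e \<Longrightarrow> e < e0 \<Longrightarrow> P (of_real (R e \<theta>)) \<theta> = of_real e"
  using R[of e \<theta>] delta_less_rho of_real_p[of "R e \<theta>" \<theta>] by simp

section \<open>Level curves\<close>

lemma continuous_on_P_P':
  assumes "continuous_on A f" "continuous_on A k" "\<And>x. x \<in> A \<Longrightarrow> norm (f x) \<le> \<rho> / 2"
  shows "continuous_on A (\<lambda>x. P (f x) (k x))" "continuous_on A (\<lambda>x. P' (f x) (k x))"
proof -
  have c: "continuous_on A (\<lambda>x. (f x * cis (k x), f x * cis (- k x)))"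
    by (intro continuous_intros assms)
  have s: "(\<lambda>x. (f x * cis (k x), f x * cis (- k x))) ` A \<subseteq> bidisc"
    using assms(3) by (auto simp: norm_mult)
  note G = continuous_on_compose2[OF continuous_on_G c s, simplified]
    continuous_on_compose2[OF continuous_on_G12(1) c s, simplified]
    continuous_on_compose2[OF continuous_on_G12(2) c s, simplified]
  show "continuous_on A (\<lambda>x. P (f x) (k x))" "continuous_on A (\<lambda>x. P' (f x) (k x))"
    unfolding P_def P'_def by (intro continuous_intros assms G)+
qed

text \<open>Compare \<open>P'_real\<close>: up to the factors \<open>2\<close> and
  \<open>2 * r\<close>, the radial and angular derivatives are the real and imaginary parts of the
  single number \<open>cis (- \<theta>) * hgrad z\<close>.\<close>

lemma p_has_angular_derivative:
  assumes "\<bar>r\<bar> < \<rho> / 2"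
  shows "((\<lambda>\<theta>. p r \<theta>) has_real_derivative 2 * r * Im (cis (- \<theta>) * hgrad (of_real r * cis \<theta>))) (at \<theta>)"
proof -
  let ?z = "of_real r * cis \<theta>"
  define g where "g = G2 ?z (of_real r * cis (- \<theta>))"
  have c: "cnj ?z = of_real r * cis (- \<theta>)"
    by (simp add: cis_cnj)
  have G1: "G1 ?z (of_real r * cis (- \<theta>)) = cnj g"
    using G2_cnj[of ?z] assms unfolding c g_def by (simp add: norm_mult)
  have 1: "((\<lambda>\<theta>. of_real r * cis \<theta>) has_derivative (\<lambda>h. of_real r * (h *\<^sub>R (\<i> * cis \<theta>)))) (at \<theta>)"
    by (intro has_derivative_mult_right has_derivative_cis[OF has_derivative_ident])
  have 2: "((\<lambda>\<theta>. of_real r * cis (- \<theta>)) has_derivative (\<lambda>h. of_real r * ((- h) *\<^sub>R (\<i> * cis (- \<theta>))))) (at \<theta>)"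
    by (intro has_derivative_mult_right has_derivative_cis has_derivative_minus has_derivative_ident)
  have "((\<lambda>\<theta>. G (of_real r * cis \<theta>) (of_real r * cis (- \<theta>))) has_derivative
      (\<lambda>h. G1 ?z (of_real r * cis (- \<theta>)) * (of_real r * (h *\<^sub>R (\<i> * cis \<theta>)))
         + G2 ?z (of_real r * cis (- \<theta>)) * (of_real r * ((- h) *\<^sub>R (\<i> * cis (- \<theta>)))))) (at \<theta>)"
    by (rule G_comp_has_derivative[OF _ _ 1 2]) (use assms in \<open>simp_all add: norm_mult\<close>)
  then have "((\<lambda>\<theta>. p r \<theta>) has_derivative
      (\<lambda>h. Re (cnj g * (of_real r * (h *\<^sub>R (\<i> * cis \<theta>))) + g * (of_real r * ((- h) *\<^sub>R (\<i> * cis (- \<theta>)))))))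
      (at \<theta>)"
    unfolding p_def P_def G1 g_def[symmetric] by (intro has_derivative_Re has_derivative_add_const[of _ _ _ "(of_real r)\<^sup>2", unfolded add.commute[of _ "(of_real r)\<^sup>2"]])
  moreover have "(\<lambda>h. Re (cnj g * (of_real r * (h *\<^sub>R (\<i> * cis \<theta>))) + g * (of_real r * ((- h) *\<^sub>R (\<i> * cis (- \<theta>))))))
      = (*) (2 * r * Im (cis (- \<theta>) * g))"
    by (rule ext) (simp add: algebra_simps)
  \<comment> \<open>The two numbers differ by \<open>cis (- \<theta>) * ?z\<close>, which is the
    real number \<open>r\<close>.\<close>
  moreover have "Im (cis (- \<theta>) * hgrad ?z) = Im (cis (- \<theta>) * g)"
    unfolding hgrad_def c g_def[symmetric] by (simp add: algebra_simps)
  ultimately show ?thesis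
    by (simp add: has_field_derivative_def)
qed

text \<open>A mean value theorem indifferent to the order of \<open>r\<close> and \<open>s\<close>.
  The lower bound on \<xi> keeps \<open>p'\<close> away from 0; the distance bound makes \<xi>
  converge along with \<open>r\<close>.\<close>

lemma p_mean_value:
  assumes "0 < r" "r < \<delta>" "0 < s" "s < \<delta>"
  shows "\<exists>\<xi>. \<bar>\<xi> - s\<bar> \<le> \<bar>r - s\<bar> \<and> min r s \<le> \<xi> \<and> \<xi> < \<delta> \<and> p r \<theta> - p s \<theta> = p' \<xi> \<theta> * (r - s)"
proof -
  have *: "\<exists>\<xi>. x < \<xi> \<and> \<xi> < y \<and> p y \<theta> - p x \<theta> = (y - x) * p' \<xi> \<theta>"
    if "0 < x" "x < y" "y < \<delta>" for x y
    by (rule MVT2[OF that(2)], rule p_has_derivative) (use that delta_less_rho in auto)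
  consider "r = s" | "r < s" | "s < r"
    by linarith
  then show ?thesis
  proof cases
    case 1
    then show ?thesis
      using assms by (intro exI[of _ s]) auto
  next
    case 2
    then obtain \<xi> where "r < \<xi>" "\<xi> < s" "p s \<theta> - p r \<theta> = (s - r) * p' \<xi> \<theta>"
      using *[of r s] assms by blast
    then show ?thesis
      using 2 assms by (intro exI[of _ \<xi>]) (auto simp: algebra_simps)
  next
    case 3
    then obtain \<xi> where "s < \<xi>" "\<xi> < r" "p r \<theta> - p s \<theta> = (r - s) * p' \<xi> \<theta>"
      using *[of s r] assms by blast
    then show ?thesis
      using 3 assms by (intro exI[of _ \<xi>]) (auto simp: algebra_simps)
  qed
qed

lemma p'_pos: "0 < r \<Longrightarrow> r < \<delta> \<Longrightarrow> p' r \<theta> > 0"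
  using p_bounds(3)[of r \<theta>] by linarith

lemma continuous_on_p_angle:
  assumes "\<bar>r\<bar> \<le> \<rho> / 2"
  shows "continuous_on UNIV (p r)"
  unfolding p_def by (intro continuous_intros continuous_on_P_P') (use assms in auto)

text \<open>Between two roots \<open>p\<close> has radial slope at least \<open>m\<close>, so the
  change of the root is controlled by the change of \<open>p\<close> when only the angle moves and
  the radius stays at \<open>R e \<theta>\<close>.\<close>

lemma R_continuous:
  assumes "0 < e" "e < e0"
  shows "isCont (R e) \<theta>"
proof -
  \<comment> \<open>All roots are at least \<open>sqrt (8 / 9 * e)\<close>, and \<open>p'\<close> is
    at least \<open>7 / 4\<close> times the radius.\<close>
  define m where "m = 7 / 4 * sqrt (8 / 9 * e)"
  have m: "m > 0"
    using assms by (simp add: m_def)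
  have lb: "sqrt (8 / 9 * e) \<le> R e \<phi>" for \<phi>
    using R_bounds(1)[OF assms, of \<phi>] R(1)[OF assms, of \<phi>] by (intro real_le_lsqrt) auto
  have bound: "\<bar>R e \<phi> - R e \<theta>\<bar> \<le> \<bar>p (R e \<theta>) \<phi> - e\<bar> / m" for \<phi>
  proof -
    obtain \<xi> where \<xi>: "min (R e \<phi>) (R e \<theta>) \<le> \<xi>" "\<xi> < \<delta>" "p (R e \<phi>) \<phi> - p (R e \<theta>) \<phi> = p' \<xi> \<phi> * (R e \<phi> - R e \<theta>)"
      using p_mean_value[of "R e \<phi>" "R e \<theta>" \<phi>] R[OF assms] by blast
    have "sqrt (8 / 9 * e) \<le> \<xi>"
      using lb[of \<phi>] lb[of \<theta>] \<xi>(1) by linarith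
    moreover have "0 \<le> sqrt (8 / 9 * e)"
      using assms by simp
    ultimately have "m \<le> p' \<xi> \<phi>"
      using p_bounds(3)[of \<xi> \<phi>] \<xi>(2) unfolding m_def by linarith
    then have "m * \<bar>R e \<phi> - R e \<theta>\<bar> \<le> \<bar>p' \<xi> \<phi> * (R e \<phi> - R e \<theta>)\<bar>"
      using m by (simp add: abs_mult mult_right_mono)
    also have "\<dots> = \<bar>p (R e \<theta>) \<phi> - e\<bar>"
      using \<xi>(3) R(3)[OF assms, of \<phi>] by linarith
    finally show ?thesis
      using m by (simp add: field_simps)
  qed
  have "isCont (p (R e \<theta>)) \<theta>"
    using continuous_on_p_angle[of "R e \<theta>"] R(1,2)[OF assms, of \<theta>] delta_less_rho
    by (simp add: continuous_on_eq_continuous_at)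
  then have "((\<lambda>\<phi>. \<bar>p (R e \<theta>) \<phi> - e\<bar> / m) \<longlongrightarrow> \<bar>p (R e \<theta>) \<theta> - e\<bar> / m) (at \<theta>)"
    using m by (intro tendsto_intros) (auto simp: isCont_def)
  then have "((\<lambda>\<phi>. \<bar>p (R e \<theta>) \<phi> - e\<bar> / m) \<longlongrightarrow> 0) (at \<theta>)"
    using R(3)[OF assms, of \<theta>] by simp
  then have "((\<lambda>\<phi>. R e \<phi> - R e \<theta>) \<longlongrightarrow> 0) (at \<theta>)"
    by (rule Lim_null_comparison[rotated]) (use bound in simp)
  then show ?thesis
    by (simp add: isCont_def LIM_zero_iff)
qed

text \<open>Implicit differentiation by difference quotients: the quotient of \<open>R e\<close> is
  minus the angular quotient of \<open>p\<close> at fixed radius, divided by \<open>p'\<close> at an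
  intermediate radius, which tends to \<open>R e \<theta>\<close> by continuity.\<close>

lemma R_has_derivative:
  assumes "0 < e" "e < e0"
  shows "(R e has_real_derivative
    - (2 * R e \<theta> * Im (cis (- \<theta>) * hgrad (of_real (R e \<theta>) * cis \<theta>))) / p' (R e \<theta>) \<theta>) (at \<theta>)"
proof -
  define D where "D = 2 * R e \<theta> * Im (cis (- \<theta>) * hgrad (of_real (R e \<theta>) * cis \<theta>))"
  have "\<exists>\<xi>. \<bar>\<xi> - R e \<theta>\<bar> \<le> \<bar>R e \<phi> - R e \<theta>\<bar> \<and> min (R e \<phi>) (R e \<theta>) \<le> \<xi> \<and> \<xi> < \<delta> \<and>
      p (R e \<phi>) \<phi> - p (R e \<theta>) \<phi> = p' \<xi> \<phi> * (R e \<phi> - R e \<theta>)" for \<phi>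
    using p_mean_value[of "R e \<phi>" "R e \<theta>" \<phi>] R[OF assms] by blast
  then obtain \<xi> where \<xi>: "\<And>\<phi>. \<bar>\<xi> \<phi> - R e \<theta>\<bar> \<le> \<bar>R e \<phi> - R e \<theta>\<bar>"
    "\<And>\<phi>. min (R e \<phi>) (R e \<theta>) \<le> \<xi> \<phi>" "\<And>\<phi>. \<xi> \<phi> < \<delta>"
    "\<And>\<phi>. p (R e \<phi>) \<phi> - p (R e \<theta>) \<phi> = p' (\<xi> \<phi>) \<phi> * (R e \<phi> - R e \<theta>)"
    by metis
  have \<xi>_pos: "\<xi> \<phi> > 0" for \<phi>
    using \<xi>(2)[of \<phi>] R(1)[OF assms, of \<theta>] R(1)[OF assms, of \<phi>] by linarith
  have "(R e \<longlongrightarrow> R e \<theta>) (at \<theta>)"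
    using R_continuous[OF assms, of \<theta>] by (simp add: isCont_def)
  then have "((\<lambda>\<phi>. \<bar>R e \<phi> - R e \<theta>\<bar>) \<longlongrightarrow> 0) (at \<theta>)"
    by (simp add: LIM_zero tendsto_rabs_zero)
  then have "((\<lambda>\<phi>. \<xi> \<phi> - R e \<theta>) \<longlongrightarrow> 0) (at \<theta>)"
    by (rule Lim_null_comparison[rotated]) (use \<xi>(1) in simp)
  then have \<xi>_lim: "(\<xi> \<longlongrightarrow> R e \<theta>) (at \<theta>)"
    by (simp add: LIM_zero_iff)
  have "((\<lambda>\<phi>. p' (\<xi> \<phi>) \<phi>) \<longlongrightarrow> p' (R e \<theta>) \<theta>) (at \<theta>)"
  proof -
    have "continuous_on ({0<..<\<delta>} \<times> UNIV) (\<lambda>q. p' (fst q) (snd q))"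
      unfolding p'_def by (intro continuous_intros continuous_on_P_P') (use delta_less_rho in auto)
    then have "isCont (\<lambda>q. p' (fst q) (snd q)) (R e \<theta>, \<theta>)"
      using R[OF assms, of \<theta>] by (subst (asm) continuous_on_eq_continuous_at) (auto simp: open_Times)
    then show ?thesis
      using isCont_tendsto_compose[OF _ tendsto_Pair[OF \<xi>_lim tendsto_ident_at]] by fastforce
  qed
  moreover have "((\<lambda>\<phi>. (p (R e \<theta>) \<phi> - p (R e \<theta>) \<theta>) / (\<phi> - \<theta>)) \<longlongrightarrow> D) (at \<theta>)"
    using p_has_angular_derivative[of "R e \<theta>" \<theta>] R(1,2)[OF assms, of \<theta>] delta_less_rho
    by (simp add: has_field_derivative_iff D_def)
  ultimately have "((\<lambda>\<phi>. - ((p (R e \<theta>) \<phi> - p (R e \<theta>) \<theta>) / (\<phi> - \<theta>)) / p' (\<xi> \<phi>) \<phi>) \<longlongrightarrow> - D / p' (R e \<theta>) \<theta>) (at \<theta>)"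
    using p'_pos[of "R e \<theta>" \<theta>] R(1,2)[OF assms, of \<theta>] by (intro tendsto_intros) auto
  \<comment> \<open>This includes \<open>\<phi> = \<theta>\<close>, where both sides are 0 since
    division by zero yields 0.\<close>
  moreover have "- ((p (R e \<theta>) \<phi> - p (R e \<theta>) \<theta>) / (\<phi> - \<theta>)) / p' (\<xi> \<phi>) \<phi> = (R e \<phi> - R e \<theta>) / (\<phi> - \<theta>)" for \<phi>
  proof -
    have "- (p (R e \<theta>) \<phi> - p (R e \<theta>) \<theta>) = p' (\<xi> \<phi>) \<phi> * (R e \<phi> - R e \<theta>)"
      using \<xi>(4)[of \<phi>] R(3)[OF assms] by simp
    then have "- ((p (R e \<theta>) \<phi> - p (R e \<theta>) \<theta>) / (\<phi> - \<theta>)) = p' (\<xi> \<phi>) \<phi> * (R e \<phi> - R e \<theta>) / (\<phi> - \<theta>)"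
      by (metis minus_divide_left)
    then show ?thesis
      using p'_pos[OF \<xi>_pos \<xi>(3), of \<phi> \<phi>] by simp
  qed
  ultimately show ?thesis
    by (simp add: has_field_derivative_iff D_def)
qed

section \<open>The period as a torus integral\<close>

text \<open>For \<open>e < e0\<close> the roots satisfy
  \<open>r\<^sup>2 < 2 / 7 * \<delta>\<^sup>2\<close>, which is below
  \<open>\<sigma>\<^sup>2 = 9 / 16 * \<delta>\<^sup>2\<close>. On the circle the modulus of
  \<open>P\<close> is at least \<open>63 / 128 * \<delta>\<^sup>2\<close>, almost twice
  \<open>e0\<close>.\<close>

definition \<sigma> :: real where
  "\<sigma> = 3 / 4 * \<delta>"

lemma sigma_pos: "\<sigma> > 0" and sigma_less: "\<sigma> < \<delta>"
  using delta_pos by (simp_all add: \<sigma>_def)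

lemma R_less_sigma:
  assumes "0 < e" "e < e0"
  shows "R e \<theta> < \<sigma>"
proof (rule power2_less_imp_less)
  show "(R e \<theta>)\<^sup>2 < \<sigma>\<^sup>2"
    using R_bounds(2)[OF assms, of \<theta>] assms delta_pos by (simp add: \<sigma>_def e0_def power_mult_distrib power_divide)
qed (use sigma_pos in simp)

lemma norm_P_circle:
  assumes "norm r = \<sigma>"
  shows "norm (P r \<theta>) \<ge> 7 / 4 * e0"
proof -
  have "7 / 4 * e0 \<le> 7 / 8 * \<sigma>\<^sup>2"
    by (simp add: \<sigma>_def e0_def power_mult_distrib power_divide)
  also have "\<dots> \<le> norm (P r \<theta>)"
    using norm_P_bounds(1)[of r \<theta>] assms sigma_less by simp
  finally show ?thesis .
qed

text \<open>The angular velocity of the flow is \<open>- pi / q e \<theta>\<close>, so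
  \<open>q e \<theta> / pi\<close> is the time spent per unit of angle.\<close>

definition q :: "real \<Rightarrow> real \<Rightarrow> real" where
  "q e \<theta> = R e \<theta> / p' (R e \<theta>) \<theta>"

lemma q_pos: "0 < e \<Longrightarrow> e < e0 \<Longrightarrow> q e \<theta> > 0"
  using R[of e \<theta>] p'_pos by (simp add: q_def)

lemma q_periodic: "q e (\<theta> + 2 * pi) = q e \<theta>"
  by (simp add: q_def R_periodic p'_def P'_periodic)

lemma continuous_on_q:
  assumes "0 < e" "e < e0"
  shows "continuous_on A (q e)"
proof -
  have R_cont: "continuous_on A (R e)"
    using R_continuous[OF assms] by (simp add: continuous_at_imp_continuous_on)
  have "continuous_on A (\<lambda>\<theta>. p' (R e \<theta>) \<theta>)"
    unfolding p'_def
  proof (intro continuous_intros continuous_on_P_P' R_cont)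
    show "norm (complex_of_real (R e \<theta>)) \<le> \<rho> / 2" for \<theta>
      using R(1,2)[OF assms, of \<theta>] delta_less_rho by simp
  qed
  then show ?thesis
    unfolding q_def using p'_pos[OF R(1,2)[OF assms]]
    by (intro continuous_intros R_cont) (auto simp: less_le)
qed

lemma continuous_on_q_shift:
  assumes "0 < e" "e < e0"
  shows "continuous_on A (\<lambda>\<theta>. q e (\<theta> + a))"
  by (rule continuous_on_compose2[OF continuous_on_q[OF assms, of UNIV]]) (auto intro!: continuous_intros)

text \<open>Both poles are simple because \<open>p'\<close> is positive. The factor \<open>r\<close>
  in the numerator makes the residues add with equal sign: at the negative root \<open>r\<close> and
  \<open>P'\<close> change sign together.\<close>

lemma residue_sum:
  assumes "0 < e" "e < e0"
  shows "contour_integral (circlepath 0 \<sigma>) (\<lambda>r. r / (P r \<theta> - of_real e)) =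
    2 * pi * \<i> * of_real (q e \<theta> + q e (\<theta> + pi))"
proof -
  define r1 r2 where "r1 = complex_of_real (R e \<theta>)" and "r2 = - complex_of_real (R e (\<theta> + pi))"
  have dist: "r1 \<noteq> r2"
    using R(1)[OF assms, of \<theta>] R(1)[OF assms, of "\<theta> + pi"] unfolding r1_def r2_def
    by (simp add: complex_eq_iff)
  have lt: "norm r1 < \<sigma>" "norm r2 < \<sigma>"
    using R(1)[OF assms] R_less_sigma[OF assms] unfolding r1_def r2_def by (simp_all add: less_imp_le)
  have root: "P r1 \<theta> - of_real e = 0" "P r2 \<theta> - of_real e = 0"
    unfolding r1_def r2_def P_minus using P_R[OF assms] by simp_all
  have P'1: "P' r1 \<theta> = of_real (p' (R e \<theta>) \<theta>)"
    unfolding r1_def using R(1,2)[OF assms, of \<theta>] delta_less_rho by (subst of_real_p') auto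
  have P'2: "P' r2 \<theta> = - of_real (p' (R e (\<theta> + pi)) (\<theta> + pi))"
    unfolding r2_def P'_minus using R(1,2)[OF assms, of "\<theta> + pi"] delta_less_rho by (subst of_real_p') auto
  have derP: "((\<lambda>r. P r \<theta> - of_real e) has_field_derivative P' r \<theta>) (at r within A)"
    if "norm r < \<delta>" for r A
    using DERIV_diff[OF P_has_derivative[of r \<theta> A] DERIV_const[of "of_real e"]] that delta_less_rho by simp
  have holP: "(\<lambda>r. P r \<theta> - of_real e) holomorphic_on ball 0 \<delta>"
    unfolding holomorphic_on_def field_differentiable_def using derP by (metis mem_ball_0)
  have hol: "(\<lambda>r. r / (P r \<theta> - of_real e)) holomorphic_on ball 0 \<delta> - {r1, r2}"
  proof (rule holomorphic_on_divide)
    show "(\<lambda>r. P r \<theta> - of_real e) holomorphic_on ball 0 \<delta> - {r1, r2}"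
      by (rule holomorphic_on_subset[OF holP]) auto
    show "P r \<theta> - of_real e \<noteq> 0" if "r \<in> ball 0 \<delta> - {r1, r2}" for r
      using P_roots[OF assms, of r \<theta>] that by (auto simp: r1_def r2_def)
  qed (intro holomorphic_intros)
  have wind: "winding_number (circlepath 0 \<sigma>) r1 = 1" "winding_number (circlepath 0 \<sigma>) r2 = 1"
    using lt by (auto intro!: winding_number_circlepath)
  have res: "residue (\<lambda>r. r / (P r \<theta> - of_real e)) s = s / P' s \<theta>"
    if "norm s < \<sigma>" "P s \<theta> - of_real e = 0" "s \<noteq> 0" "P' s \<theta> \<noteq> 0" for s
    by (rule residue_simple_pole_deriv[of _ "ball 0 \<delta>"])
      (use that sigma_less holP in \<open>auto intro!: holomorphic_intros derP\<close>)
  have res1: "residue (\<lambda>r. r / (P r \<theta> - of_real e)) r1 = of_real (q e \<theta>)"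
  proof -
    have "r1 \<noteq> 0" "P' r1 \<theta> \<noteq> 0"
      using p'_pos[OF R(1,2)[OF assms], of \<theta> \<theta>] R(1)[OF assms, of \<theta>] unfolding P'1
      by (simp_all add: r1_def)
    then show ?thesis
      unfolding res[OF lt(1) root(1) \<open>r1 \<noteq> 0\<close> \<open>P' r1 \<theta> \<noteq> 0\<close>] P'1
      by (simp add: q_def r1_def)
  qed
  have res2: "residue (\<lambda>r. r / (P r \<theta> - of_real e)) r2 = of_real (q e (\<theta> + pi))"
  proof -
    have "r2 \<noteq> 0" "P' r2 \<theta> \<noteq> 0"
      using p'_pos[OF R(1,2)[OF assms], of "\<theta> + pi" "\<theta> + pi"] R(1)[OF assms, of "\<theta> + pi"] unfolding P'2
      by (simp_all add: r2_def)
    then show ?thesis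
      unfolding res[OF lt(2) root(2) \<open>r2 \<noteq> 0\<close> \<open>P' r2 \<theta> \<noteq> 0\<close>] P'2
      by (simp add: q_def r2_def)
  qed
  have "contour_integral (circlepath 0 \<sigma>) (\<lambda>r. r / (P r \<theta> - of_real e)) =
      2 * pi * \<i> * (\<Sum>x\<in>{r1, r2}. winding_number (circlepath 0 \<sigma>) x * residue (\<lambda>r. r / (P r \<theta> - of_real e)) x)"
  proof (rule Residue_theorem[OF open_ball connected_ball _ hol])
    show "path_image (circlepath 0 \<sigma>) \<subseteq> ball 0 \<delta> - {r1, r2}"
      using lt sigma_pos sigma_less by auto
    show "\<forall>z. z \<notin> ball 0 \<delta> \<longrightarrow> winding_number (circlepath 0 \<sigma>) z = 0"
      using sigma_pos sigma_less
      by (auto intro!: winding_number_zero_outside[where s = "ball 0 \<delta>"])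
  qed auto
  then show ?thesis
    using dist by (simp add: wind res1 res2)
qed

text \<open>On the circle \<open>dr = \<i> * r * d\<phi>\<close>, which raises the numerator from
  \<open>r\<close> to \<open>r\<^sup>2\<close>.\<close>

lemma angular_integral:
  assumes "0 < e" "e < e0"
  shows "integral {0..2 * pi} (\<lambda>\<phi>. (of_real \<sigma> * cis \<phi>)\<^sup>2 / (P (of_real \<sigma> * cis \<phi>) \<theta> - of_real e)) =
    2 * pi * of_real (q e \<theta> + q e (\<theta> + pi))"
proof -
  have "contour_integral (circlepath 0 \<sigma>) (\<lambda>r. r / (P r \<theta> - of_real e)) =
      integral {0..2 * pi} (\<lambda>\<phi>. (of_real \<sigma> * cis \<phi>) / (P (of_real \<sigma> * cis \<phi>) \<theta> - of_real e) * \<sigma> * \<i> * cis \<phi>)"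
    unfolding circlepath_def by (subst contour_integral_part_circlepath_eq) (simp_all add: mult_ac)
  also have "\<dots> = integral {0..2 * pi} (\<lambda>\<phi>. \<i> * ((of_real \<sigma> * cis \<phi>)\<^sup>2 / (P (of_real \<sigma> * cis \<phi>) \<theta> - of_real e)))"
    by (rule integral_cong) (simp add: power2_eq_square mult_ac)
  also have "\<dots> = \<i> * integral {0..2 * pi} (\<lambda>\<phi>. (of_real \<sigma> * cis \<phi>)\<^sup>2 / (P (of_real \<sigma> * cis \<phi>) \<theta> - of_real e))"
    by (rule integral_mult_right)
  finally have "\<i> * integral {0..2 * pi} (\<lambda>\<phi>. (of_real \<sigma> * cis \<phi>)\<^sup>2 / (P (of_real \<sigma> * cis \<phi>) \<theta> - of_real e)) =
      \<i> * (2 * pi * of_real (q e \<theta> + q e (\<theta> + pi)))"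
    unfolding residue_sum[OF assms, of \<theta>] by (simp add: mult_ac)
  then show ?thesis
    by (simp only: mult_cancel_left) simp
qed

definition period :: "real \<Rightarrow> real" where
  "period e = integral {0..2 * pi} (q e) / pi"

text \<open>Points of the torus are pairs \<open>(\<theta>, \<phi>)\<close>, where \<open>r = \<sigma> * cis \<phi>\<close>.\<close>

abbreviation torus :: "(real \<times> real) set" where
  "torus \<equiv> cbox (0, 0) (2 * pi, 2 * pi)"

abbreviation P_torus :: "real \<times> real \<Rightarrow> complex" where
  "P_torus x \<equiv> P (of_real \<sigma> * cis (snd x)) (fst x)"

lemma continuous_on_P_torus: "continuous_on A P_torus"
  by (intro continuous_on_P_P' continuous_intros)
    (use sigma_pos sigma_less delta_less_rho in \<open>auto simp: norm_mult\<close>)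

lemma norm_P_torus: "norm (P_torus x) \<ge> 7 / 4 * e0"
  using sigma_pos by (intro norm_P_circle) (simp add: norm_mult)

lemma integral_periodic_shift:
  fixes f :: "real \<Rightarrow> real"
  assumes "continuous_on UNIV f" "\<And>x. f (x + 2 * pi) = f x"
  shows "integral {0..2 * pi} (\<lambda>x. f (x + pi)) = integral {0..2 * pi} f"
proof -
  have int: "f integrable_on {a..b}" for a b
    using assms(1) continuous_on_subset integrable_continuous_real subset_UNIV by blast
  have shift: "integral {a..b} (\<lambda>x. f (x + c)) = integral {a + c..b + c} f" for a b c
    using integral_shift_Icc_real[of a b f c] by (simp add: o_def add.commute)
  have "integral {0..2 * pi} (\<lambda>x. f (x + pi)) = integral {pi..2 * pi + pi} f"
    using shift[of 0 "2 * pi" pi] by simp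
  also have "\<dots> = integral {pi..2 * pi} f + integral {2 * pi..2 * pi + pi} f"
    by (rule Henstock_Kurzweil_Integration.integral_combine[symmetric]) (auto intro: int)
  also have "integral {2 * pi..2 * pi + pi} f = integral {0..pi} f"
    using shift[of 0 pi "2 * pi"] by (simp add: assms(2) add.commute)
  also have "integral {pi..2 * pi} f + integral {0..pi} f = integral {0..2 * pi} f"
    using Henstock_Kurzweil_Integration.integral_combine[of 0 pi "2 * pi" f] int by simp
  finally show ?thesis .
qed

text \<open>The two residues have the same mean over \<theta>, as \<open>q e\<close> is periodic.
  The torus does not depend on \<open>e\<close>, so the energy now occurs only as an explicit
  parameter of the integrand.\<close>

lemma period_torus:
  assumes "0 < e" "e < e0"
  shows "of_real (4 * pi\<^sup>2 * period e) =
    integral torus (\<lambda>x. (of_real \<sigma> * cis (snd x))\<^sup>2 / (P_torus x - of_real e))"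
proof -
  have ne: "P_torus x - of_real e \<noteq> 0" for x
    using norm_P_torus[of x] assms by (auto simp del: of_real_mult)
  have "integral torus (\<lambda>x. (of_real \<sigma> * cis (snd x))\<^sup>2 / (P_torus x - of_real e)) =
      integral {0..2 * pi} (\<lambda>\<theta>. integral {0..2 * pi}
        (\<lambda>\<phi>. (of_real \<sigma> * cis \<phi>)\<^sup>2 / (P (of_real \<sigma> * cis \<phi>) \<theta> - of_real e)))"
    by (subst integral_prod_continuous)
      (use ne in \<open>auto intro!: continuous_intros continuous_on_P_torus\<close>)
  also have "\<dots> = integral {0..2 * pi} (\<lambda>\<theta>. of_real (2 * pi * (q e \<theta> + q e (\<theta> + pi))))"
    by (simp add: angular_integral[OF assms])
  also have "\<dots> = of_real (integral {0..2 * pi} (\<lambda>\<theta>. 2 * pi * (q e \<theta> + q e (\<theta> + pi))))"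
    by (intro integral_unique has_integral_of_real integrable_integral integrable_continuous_real
        continuous_intros continuous_on_q[OF assms] continuous_on_q_shift[OF assms])
  also have "integral {0..2 * pi} (\<lambda>\<theta>. 2 * pi * (q e \<theta> + q e (\<theta> + pi))) =
      2 * pi * (integral {0..2 * pi} (q e) + integral {0..2 * pi} (\<lambda>\<theta>. q e (\<theta> + pi)))"
    by (subst integral_mult_right, subst Henstock_Kurzweil_Integration.integral_add)
      (auto intro!: integrable_continuous_real continuous_on_q[OF assms] continuous_on_q_shift[OF assms] continuous_intros)
  also have "integral {0..2 * pi} (\<lambda>\<theta>. q e (\<theta> + pi)) = integral {0..2 * pi} (q e)"
    by (rule integral_periodic_shift[OF continuous_on_q[OF assms] q_periodic])
  also have "2 * pi * (integral {0..2 * pi} (q e) + integral {0..2 * pi} (q e)) = 4 * pi\<^sup>2 * period e"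
    by (simp add: period_def power2_eq_square)
  finally show ?thesis
    by simp
qed

end

section \<open>Powers of series, integration of series and averages on the circle\<close>

lemma has_sum_power_lists:
  fixes f :: "'a \<Rightarrow> complex"
  assumes "(f has_sum F) A"
  shows "((\<lambda>bs. prod_list (map f bs)) has_sum F ^ s) {bs. length bs = s \<and> set bs \<subseteq> A}"
proof (induction s)
  case 0
  have "{bs :: 'a list. length bs = 0 \<and> set bs \<subseteq> A} = {[]}"
    by auto
  then show ?case
    by (simp add: has_sum_finiteI)
next
  case (Suc s)
  let ?L = "{bs. length bs = s \<and> set bs \<subseteq> A}"
  \<comment> \<open>For complex terms unordered summability is absolute, and absolute summability
    passes to the product of the index sets.\<close>
  have abs: "(\<lambda>b. norm (f b)) summable_on A" "(\<lambda>bs. norm (prod_list (map f bs))) summable_on ?L"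
    using has_sum_imp_summable[OF assms] has_sum_imp_summable[OF Suc.IH]
    by (simp_all only: summable_on_iff_abs_summable_on_complex)
  have "((\<lambda>(b, bs). f b * prod_list (map f bs)) has_sum F * F ^ s) (A \<times> ?L)"
  proof (rule has_sum_SigmaI)
    show "((\<lambda>bs. case (b, bs) of (b, bs) \<Rightarrow> f b * prod_list (map f bs)) has_sum f b * F ^ s) ?L" for b
      using has_sum_cmult_right[OF Suc.IH, of "f b"] by simp
    show "((\<lambda>b. f b * F ^ s) has_sum F * F ^ s) A"
      by (rule has_sum_cmult_left[OF assms])
    show "(\<lambda>(b, bs). f b * prod_list (map f bs)) summable_on A \<times> ?L"
      unfolding summable_on_iff_abs_summable_on_complex
    proof (rule Infinite_Sum.abs_summable_on_Sigma_iff[THEN iffD2], intro conjI ballI)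
      show "(\<lambda>bs. norm (case (b, bs) of (b, bs) \<Rightarrow> f b * prod_list (map f bs))) summable_on ?L" for b
        using summable_on_cmult_right[OF abs(2), of "norm (f b)"] by (simp add: norm_mult)
      have "(\<lambda>b. norm (f b) * (\<Sum>\<^sub>\<infinity>bs\<in>?L. norm (prod_list (map f bs)))) summable_on A"
        by (rule summable_on_cmult_left[OF abs(1)])
      then show "(\<lambda>b. norm (\<Sum>\<^sub>\<infinity>bs\<in>?L. norm (case (b, bs) of (b, bs) \<Rightarrow> f b * prod_list (map f bs)))) summable_on A"
        by (simp add: norm_mult infsum_cmult_right' abs_mult infsum_nonneg)
    qed
  qed
  also have "(\<lambda>(b, bs). f b * prod_list (map f bs)) = (\<lambda>bs. prod_list (map f bs)) \<circ> (\<lambda>(b, bs). b # bs)"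
    by auto
  finally have "((\<lambda>bs. prod_list (map f bs)) has_sum F * F ^ s) ((\<lambda>(b, bs). b # bs) ` (A \<times> ?L))"
    by (subst has_sum_reindex) (simp_all only: inj_on_def split: prod.splits, simp)
  also have "(\<lambda>(b, bs). b # bs) ` (A \<times> ?L) = {bs. length bs = Suc s \<and> set bs \<subseteq> A}"
    by (auto simp: length_Suc_conv image_iff)
  finally show ?case
    by simp
qed

text \<open>The M-test for unordered sums; it serves series over \<open>nat\<close> as well as
  series over lists of exponents.\<close>

lemma integral_has_sum:
  fixes f :: "'i \<Rightarrow> 'a::euclidean_space \<Rightarrow> complex"
  assumes "\<And>i. continuous_on (cbox a b) (f i)"
    and "\<And>i x. i \<in> I \<Longrightarrow> x \<in> cbox a b \<Longrightarrow> norm (f i x) \<le> M i" and "M summable_on I"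
    and "\<And>x. x \<in> cbox a b \<Longrightarrow> ((\<lambda>i. f i x) has_sum S x) I"
  shows "((\<lambda>i. integral (cbox a b) (f i)) has_sum integral (cbox a b) S) I"
proof -
  have "uniform_limit (cbox a b) (\<lambda>X x. \<Sum>i\<in>X. f i x) S (finite_subsets_at_top I)"
    by (rule Weierstrass_m_test_general'[OF assms(2,4,3)])
  then obtain J K where J: "\<And>X. ((\<lambda>x. \<Sum>i\<in>X. f i x) has_integral J X) (cbox a b)"
    and K: "(S has_integral K) (cbox a b)" "(J \<longlongrightarrow> K) (finite_subsets_at_top I)"
    by (rule uniform_limit_integral_cbox) (auto intro!: continuous_on_sum assms(1) finite_subsets_at_top_neq_bot)
  have "J X = (\<Sum>i\<in>X. integral (cbox a b) (f i))" if "finite X" for X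
    using integral_unique[OF J[of X]] that
    by (simp add: Henstock_Kurzweil_Integration.integral_sum integrable_continuous assms(1))
  then have "((\<lambda>X. \<Sum>i\<in>X. integral (cbox a b) (f i)) \<longlongrightarrow> K) (finite_subsets_at_top I)"
    by (intro Lim_transform_eventually[OF K(2)] eventually_finite_subsets_at_top_weakI)
  then show ?thesis
    using K(1) by (simp add: has_sum_def integral_unique)
qed

lemma integral_cis_multiple:
  "integral {0..2 * pi} (\<lambda>t. cis (of_int m * t)) = (if m = 0 then 2 * pi else 0)"
proof (cases "m = 0")
  case False
  have "((\<lambda>t. cis (of_int m * t)) has_integral
      (cis (of_int m * (2 * pi)) / (\<i> * of_int m) - cis (of_int m * 0) / (\<i> * of_int m))) {0..2 * pi}"
  proof (rule fundamental_theorem_of_calculus)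
    fix t :: real
    have "((\<lambda>t. of_int m * t) has_derivative (\<lambda>h. of_int m * h)) (at t within {0..2 * pi})"
      by (intro has_derivative_mult_right has_derivative_ident)
    note has_derivative_mult_right[OF has_derivative_cis[OF this], of "1 / (\<i> * of_int m)"]
    also have "(\<lambda>h. 1 / (\<i> * of_int m) * ((of_int m * h) *\<^sub>R (\<i> * cis (of_int m * t)))) = (\<lambda>h. h *\<^sub>R cis (of_int m * t))"
    proof
      fix h
      have "1 / (\<i> * of_int m) * ((of_int m * h) *\<^sub>R (\<i> * cis (of_int m * t))) =
          1 / (\<i> * of_int m) * (\<i> * of_int m) * (of_real h * cis (of_int m * t))"
        by (simp only: scaleR_conv_of_real of_real_mult of_real_of_int_eq mult_ac)
      then show "1 / (\<i> * of_int m) * ((of_int m * h) *\<^sub>R (\<i> * cis (of_int m * t))) = h *\<^sub>R cis (of_int m * t)"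
        using False by (simp add: scaleR_conv_of_real)
    qed
    finally show "((\<lambda>t. cis (of_int m * t) / (\<i> * of_int m)) has_vector_derivative cis (of_int m * t)) (at t within {0..2 * pi})"
      by (simp add: has_vector_derivative_def)
  qed simp
  moreover have "cis (of_int m * (2 * pi)) = 1"
    by (metis cis_multiple_2pi Ints_of_int mult.commute)
  ultimately show ?thesis
    using False by (simp add: integral_unique)
qed (simp add: scaleR_conv_of_real)

lemma negative_binomial_sums:
  fixes z :: complex
  assumes "norm z < 1"
  shows "(\<lambda>s. (-1) ^ s * of_nat ((d + s) choose s) * z ^ s) sums (1 / (1 + z) ^ (d + 1))"
proof -
  have nz: "1 + z \<noteq> 0"
    using assms by (metis add.inverse_unique less_irrefl norm_minus_cancel norm_one)
  have "(- of_nat (d + 1) gchoose s) = (-1) ^ s * (of_nat ((d + s) choose s) :: complex)" for s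
    unfolding gbinomial_minus binomial_gbinomial by (simp add: algebra_simps)
  then show ?thesis
    using gen_binomial_complex[OF assms, of "- of_nat (d + 1)"] nz
    unfolding powr_minus powr_complexpow[OF nz] by (simp add: divide_inverse)
qed

lemma prod_list_monomials:
  "prod_list (map (\<lambda>\<beta>. g \<beta> * z ^ fst \<beta> * w ^ snd \<beta>) bs) =
    prod_list (map g bs) * z ^ fst (sum_list bs) * w ^ snd (sum_list bs)"
  for g :: "nat \<times> nat \<Rightarrow> complex"
  by (induction bs) (simp_all add: power_add algebra_simps)

lemma index_tuples_alt:
  "index_tuples d k = {bs. length bs = k \<and> set bs \<subseteq> {\<beta>. fst \<beta> + snd \<beta> \<ge> 3} \<and> sum_list bs = (d + k, d + k)}"
  by (auto simp: index_tuples_def)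

context real_cubic_series
begin

section \<open>Monomials on the torus and the expansion in the energy\<close>

abbreviation zt :: "real \<times> real \<Rightarrow> complex" where
  "zt x \<equiv> of_real \<sigma> * cis (snd x) * cis (fst x)"

abbreviation wt :: "real \<times> real \<Rightarrow> complex" where
  "wt x \<equiv> of_real \<sigma> * cis (snd x) * cis (- fst x)"

lemma zt_wt: "zt x * wt x = (of_real \<sigma> * cis (snd x))\<^sup>2"
proof -
  have "zt x * wt x = (of_real \<sigma> * cis (snd x))\<^sup>2 * (cis (fst x) * cis (- fst x))"
    by (simp only: power2_eq_square mult_ac)
  then show ?thesis
    by (simp add: cis_mult)
qed

lemma norm_zt_wt: "norm (zt x) = \<sigma>" "norm (wt x) = \<sigma>"
  using sigma_pos by (simp_all add: norm_mult)

lemma zt_wt_nonzero: "zt x \<noteq> 0" "wt x \<noteq> 0"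
  using sigma_pos by simp_all

text \<open>The angle \<open>fst x\<close> detects \<open>i - j\<close> and the phase
  \<open>snd x\<close> of the complex radius detects \<open>i + j - 2 * n\<close>. The average over
  real angles alone would enforce only \<open>i = j\<close>; the second one isolates a single
  degree.\<close>

lemma torus_monomial_integral:
  "integral torus (\<lambda>x. zt x ^ i * wt x ^ j / (zt x * wt x) ^ n) =
    (if i = n \<and> j = n then 4 * pi\<^sup>2 else 0)"
proof -
  define m k where "m = int i - int j" and "k = int i + int j - 2 * int n"
  have eq: "zt x ^ i * wt x ^ j / (zt x * wt x) ^ n =
      of_real (\<sigma> ^ i * \<sigma> ^ j / \<sigma> ^ (2 * n)) * (cis (of_int m * fst x) * cis (of_int k * snd x))" for x
  proof -
    have "zt x ^ i = of_real (\<sigma> ^ i) * cis (real i * (snd x + fst x))"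
      "wt x ^ j = of_real (\<sigma> ^ j) * cis (real j * (snd x - fst x))"
      by (simp_all add: power_mult_distrib mult.assoc cis_mult Complex.DeMoivre)
    moreover have "(zt x * wt x) ^ n = of_real (\<sigma> ^ (2 * n)) * cis (real (2 * n) * snd x)"
      unfolding zt_wt power_mult[symmetric] by (simp only: power_mult_distrib of_real_power Complex.DeMoivre)
    ultimately have "zt x ^ i * wt x ^ j / (zt x * wt x) ^ n =
        of_real (\<sigma> ^ i * \<sigma> ^ j / \<sigma> ^ (2 * n)) *
        (cis (real i * (snd x + fst x)) * cis (real j * (snd x - fst x)) / cis (real (2 * n) * snd x))"
      by simp
    also have "cis (real i * (snd x + fst x)) * cis (real j * (snd x - fst x)) / cis (real (2 * n) * snd x) =
        cis (of_int m * fst x) * cis (of_int k * snd x)"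
      unfolding cis_mult cis_divide m_def k_def by (simp add: algebra_simps)
    finally show ?thesis .
  qed
  have "integral torus (\<lambda>x. cis (of_int m * fst x) * cis (of_int k * snd x)) =
      integral {0..2 * pi} (\<lambda>\<theta>. integral {0..2 * pi} (\<lambda>\<phi>. cis (of_int m * \<theta>) * cis (of_int k * \<phi>)))"
    by (subst integral_prod_continuous) (auto intro!: continuous_intros)
  also have "\<dots> = integral {0..2 * pi} (\<lambda>\<theta>. cis (of_int m * \<theta>) * (if k = 0 then 2 * pi else 0))"
    unfolding integral_mult_right integral_cis_multiple ..
  also have "\<dots> = (if m = 0 then 2 * pi else 0) * (if k = 0 then 2 * pi else 0)"
    unfolding integral_mult_left integral_cis_multiple of_real_mult ..
  finally have int: "integral torus (\<lambda>x. cis (of_int m * fst x) * cis (of_int k * snd x)) =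
      (if m = 0 then 2 * pi else 0) * (if k = 0 then 2 * pi else 0)" .
  have mk: "m = 0 \<and> k = 0 \<longleftrightarrow> i = n \<and> j = n"
    by (auto simp: m_def k_def)
  show ?thesis
    unfolding eq integral_mult_right int using mk sigma_pos
    by (auto simp: power2_eq_square simp flip: power_add mult_2)
qed

definition mean_coeff :: "nat \<Rightarrow> complex" where
  "mean_coeff d = integral torus (\<lambda>x. (of_real \<sigma> * cis (snd x))\<^sup>2 / P_torus x ^ (d + 1)) / (4 * pi\<^sup>2)"

lemma period_has_sum:
  assumes "0 < e" "e < e0"
  shows "((\<lambda>d. mean_coeff d * of_real e ^ d) has_sum of_real (period e)) UNIV"
proof -
  \<comment> \<open>The first factor bounds \<open>r\<^sup>2 / P\<close> on the torus;
    \<open>4 / 7\<close> is \<open>e0\<close> divided by the lower bound \<open>7 / 4 * e0\<close>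
    for the norm of \<open>P\<close>.\<close>
  define M where "M d = \<sigma>\<^sup>2 / (7 / 4 * e0) * (4 / 7) ^ d" for d :: nat
  have P0: "P_torus x \<noteq> 0" for x
    using norm_P_torus[of x] e0_pos by auto
  have ratio: "norm (of_real e / P_torus x) \<le> 4 / 7" for x
  proof -
    have "norm (of_real e / P_torus x) \<le> e0 / (7 / 4 * e0)"
      unfolding norm_divide using norm_P_torus[of x] assms by (intro frac_le) auto
    then show ?thesis
      using e0_pos by simp
  qed
  have "((\<lambda>d. integral torus (\<lambda>x. (of_real \<sigma> * cis (snd x))\<^sup>2 / P_torus x * (of_real e / P_torus x) ^ d)) has_sum
      integral torus (\<lambda>x. (of_real \<sigma> * cis (snd x))\<^sup>2 / (P_torus x - of_real e))) UNIV"
  proof (rule integral_has_sum[where M = M])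
    show "continuous_on torus (\<lambda>x. (of_real \<sigma> * cis (snd x))\<^sup>2 / P_torus x * (of_real e / P_torus x) ^ d)" for d
      using P0 by (intro continuous_intros continuous_on_P_torus) auto
    have bound: "norm ((of_real \<sigma> * cis (snd x))\<^sup>2 / P_torus x * (of_real e / P_torus x) ^ d) \<le> M d" for d x
    proof -
      have "norm ((of_real \<sigma> * cis (snd x))\<^sup>2 / P_torus x) = \<sigma>\<^sup>2 / norm (P_torus x)"
        by (simp add: norm_divide norm_mult norm_power)
      also have "\<dots> \<le> \<sigma>\<^sup>2 / (7 / 4 * e0)"
        using norm_P_torus[of x] e0_pos by (intro frac_le) auto
      finally show ?thesis
        unfolding M_def norm_mult[of _ "_ ^ d"] norm_power[of _ d]
        using ratio[of x] e0_pos by (intro mult_mono power_mono) auto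
    qed
    then show "norm ((of_real \<sigma> * cis (snd x))\<^sup>2 / P_torus x * (of_real e / P_torus x) ^ d) \<le> M d" for d x .
    have sM: "summable M"
      unfolding M_def by (intro summable_mult summable_geometric) simp
    have M0: "M d \<ge> 0" for d
      using e0_pos by (simp add: M_def)
    show "M summable_on UNIV"
      using norm_summable_imp_summable_on[of M] sM M0 by simp
    show "((\<lambda>d. (of_real \<sigma> * cis (snd x))\<^sup>2 / P_torus x * (of_real e / P_torus x) ^ d) has_sum
        (of_real \<sigma> * cis (snd x))\<^sup>2 / (P_torus x - of_real e)) UNIV" for x
    proof (rule norm_summable_imp_has_sum)
      show "summable (\<lambda>d. norm ((of_real \<sigma> * cis (snd x))\<^sup>2 / P_torus x * (of_real e / P_torus x) ^ d))"
        by (rule summable_comparison_test[OF _ sM]) (use bound in simp)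
      have "(\<lambda>d. (of_real e / P_torus x) ^ d) sums (1 / (1 - of_real e / P_torus x))"
        by (rule geometric_sums) (use ratio[of x] in simp)
      then have "(\<lambda>d. (of_real \<sigma> * cis (snd x))\<^sup>2 / P_torus x * (of_real e / P_torus x) ^ d) sums
          ((of_real \<sigma> * cis (snd x))\<^sup>2 / P_torus x * (1 / (1 - of_real e / P_torus x)))"
        by (rule sums_mult)
      also have "(of_real \<sigma> * cis (snd x))\<^sup>2 / P_torus x * (1 / (1 - of_real e / P_torus x)) =
          (of_real \<sigma> * cis (snd x))\<^sup>2 / (P_torus x - of_real e)"
      proof -
        have "P_torus x * (1 - of_real e / P_torus x) = P_torus x - of_real e"
          using P0[of x] by (simp add: right_diff_distrib)
        then show ?thesis
          by (simp only: times_divide_times_eq mult_1_right)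
      qed
      finally show "(\<lambda>d. (of_real \<sigma> * cis (snd x))\<^sup>2 / P_torus x * (of_real e / P_torus x) ^ d) sums
          ((of_real \<sigma> * cis (snd x))\<^sup>2 / (P_torus x - of_real e))" .
    qed
  qed
  also have "(\<lambda>d. integral torus (\<lambda>x. (of_real \<sigma> * cis (snd x))\<^sup>2 / P_torus x * (of_real e / P_torus x) ^ d)) =
      (\<lambda>d. of_real (4 * pi\<^sup>2) * (mean_coeff d * of_real e ^ d))"
  proof
    fix d
    have "integral torus (\<lambda>x. (of_real \<sigma> * cis (snd x))\<^sup>2 / P_torus x * (of_real e / P_torus x) ^ d) =
        integral torus (\<lambda>x. (of_real \<sigma> * cis (snd x))\<^sup>2 / P_torus x ^ (d + 1) * of_real e ^ d)"
      by (simp add: power_divide)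
    also have "\<dots> = of_real (4 * pi\<^sup>2) * (mean_coeff d * of_real e ^ d)"
      unfolding integral_mult_left mean_coeff_def by simp
    finally show "integral torus (\<lambda>x. (of_real \<sigma> * cis (snd x))\<^sup>2 / P_torus x * (of_real e / P_torus x) ^ d) =
        of_real (4 * pi\<^sup>2) * (mean_coeff d * of_real e ^ d)" .
  qed
  also have "integral torus (\<lambda>x. (of_real \<sigma> * cis (snd x))\<^sup>2 / (P_torus x - of_real e)) =
      of_real (4 * pi\<^sup>2) * of_real (period e)"
    using period_torus[OF assms] by simp
  finally show ?thesis
    by (subst (asm) has_sum_cmult_right_iff) simp_all
qed

section \<open>Coefficients of the period function\<close>

definition tuple_sum :: "nat \<Rightarrow> nat \<Rightarrow> complex" where
  "tuple_sum d s = (\<Sum>bs\<in>index_tuples d s. prod_list (map g bs))"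

lemma G_torus_has_sum:
  "((\<lambda>\<beta>. g \<beta> * zt x ^ fst \<beta> * wt x ^ snd \<beta>) has_sum G (zt x) (wt x)) {\<beta>. fst \<beta> + snd \<beta> \<ge> 3}"
  using sigma_less delta_less_rho by (intro G_has_sum) (simp_all only: norm_zt_wt)

text \<open>In the expanded power only the lists whose monomial is \<open>(z * w) ^ (d + s)\<close>
  survive integration. They form the finite set \<open>index_tuples d s\<close>.\<close>

lemma integral_G_power:
  "integral torus (\<lambda>x. G (zt x) (wt x) ^ s / (zt x * wt x) ^ (d + s)) = 4 * pi\<^sup>2 * tuple_sum d s"
proof -
  let ?S = "{\<beta> :: nat \<times> nat. fst \<beta> + snd \<beta> \<ge> 3}"
  let ?L = "{bs. length bs = s \<and> set bs \<subseteq> ?S}"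
  let ?f = "\<lambda>bs x. prod_list (map g bs) * (zt x ^ fst (sum_list bs) * wt x ^ snd (sum_list bs) / (zt x * wt x) ^ (d + s))"
  \<comment> \<open>The majorant is the exact norm of the term, which is constant on the torus as
    both coordinates have modulus \<sigma>.\<close>
  define M where "M bs = norm (prod_list (map (\<lambda>\<beta>. g \<beta> * of_real \<sigma> ^ fst \<beta> * of_real \<sigma> ^ snd \<beta>) bs)) / (\<sigma>\<^sup>2) ^ (d + s)" for bs
  have norm_term: "norm (?f bs x) = M bs" for bs x
    unfolding M_def prod_list_monomials using sigma_pos
    by (simp add: norm_divide norm_mult norm_power norm_zt_wt power2_eq_square mult.assoc)
  have int: "((\<lambda>bs. integral torus (?f bs)) has_sum integral torus (\<lambda>x. G (zt x) (wt x) ^ s / (zt x * wt x) ^ (d + s))) ?L"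
  proof (rule integral_has_sum[where M = M])
    show "continuous_on torus (?f bs)" for bs
      using zt_wt_nonzero by (intro continuous_intros) auto
    show "norm (?f bs x) \<le> M bs" for bs x
      by (simp only: norm_term)
    \<comment> \<open>At the torus point \<open>0\<close> both coordinates equal \<sigma>, so
      convergence at one point supplies the majorant.\<close>
    have "((\<lambda>\<beta>. g \<beta> * of_real \<sigma> ^ fst \<beta> * of_real \<sigma> ^ snd \<beta>) has_sum G (of_real \<sigma>) (of_real \<sigma>)) ?S"
      using G_torus_has_sum[of 0] by simp
    from has_sum_imp_summable[OF has_sum_power_lists[OF this]]
    have "(\<lambda>bs. norm (prod_list (map (\<lambda>\<beta>. g \<beta> * of_real \<sigma> ^ fst \<beta> * of_real \<sigma> ^ snd \<beta>) bs))) summable_on ?L"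
      by (simp only: summable_on_iff_abs_summable_on_complex)
    then show "M summable_on ?L"
      unfolding M_def divide_inverse by (rule summable_on_cmult_left)
    show "((\<lambda>bs. ?f bs x) has_sum G (zt x) (wt x) ^ s / (zt x * wt x) ^ (d + s)) ?L" for x
      using has_sum_cmult_left[OF has_sum_power_lists[OF G_torus_has_sum[of x], of s], of "inverse ((zt x * wt x) ^ (d + s))"]
      unfolding prod_list_monomials by (simp only: divide_inverse mult.assoc)
  qed
  have "integral torus (?f bs) = (if sum_list bs = (d + s, d + s) then of_real (4 * pi\<^sup>2) * prod_list (map g bs) else 0)" for bs
    unfolding integral_mult_right torus_monomial_integral by (auto simp: prod_eq_iff)
  moreover have "((\<lambda>bs. if sum_list bs = (d + s, d + s) then of_real (4 * pi\<^sup>2) * prod_list (map g bs) else 0)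
      has_sum of_real (4 * pi\<^sup>2) * tuple_sum d s) ?L"
    by (rule has_sum_finite_neutralI[OF finite_index_tuples[of d s]])
      (auto simp: index_tuples_alt tuple_sum_def sum_distrib_left)
  ultimately show ?thesis
    using has_sum_unique[OF int] by simp
qed

text \<open>With \<open>r\<^sup>2 = z * w\<close> the integrand is \<open>(z * w) ^ d\<close> in the
  denominator times the binomial series of exponent \<open>- (d + 1)\<close> in
  \<open>G / (z * w)\<close>. The sum stops at \<open>2 * d\<close> because longer tuples have too
  large a total degree.\<close>

lemma mean_coeff_eq: "mean_coeff d = (\<Sum>s\<le>2 * d. (-1) ^ s * of_nat ((d + s) choose s) * tuple_sum d s)"
proof -
  \<comment> \<open>\<open>2 ^ (d + s)\<close> bounds the binomial coefficient and
    \<open>1 / 8\<close> the ratio \<open>G / (z * w)\<close>; together they decay like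
    \<open>(1 / 4) ^ s\<close>.\<close>
  define M where "M s = 2 ^ (d + s) * (1 / 8) ^ s / (\<sigma>\<^sup>2) ^ d" for s :: nat
  let ?f = "\<lambda>s x. (-1) ^ s * of_nat ((d + s) choose s) * (G (zt x) (wt x) ^ s / (zt x * wt x) ^ (d + s))"
  have A0: "zt x * wt x \<noteq> 0" for x
    using zt_wt_nonzero by simp
  have P_eq: "P_torus x = zt x * wt x + G (zt x) (wt x)" for x
    by (simp only: P_def zt_wt)
  have ratio: "norm (G (zt x) (wt x) / (zt x * wt x)) \<le> 1 / 8" for x
  proof -
    have "norm (G (zt x) (wt x)) \<le> (norm (of_real \<sigma> * cis (snd x)))\<^sup>2 / 8"
      using P_bounds(1)[of "of_real \<sigma> * cis (snd x)" "fst x"] sigma_pos sigma_less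
      by (simp add: P_def norm_mult)
    then show ?thesis
      using sigma_pos unfolding norm_divide norm_mult[of "zt x"] norm_zt_wt
      by (simp add: norm_mult power2_eq_square field_simps)
  qed
  have factor: "?f s x = 1 / (zt x * wt x) ^ d * ((-1) ^ s * of_nat ((d + s) choose s) * (G (zt x) (wt x) / (zt x * wt x)) ^ s)" for s x
    by (simp add: power_add power_divide)
  have bound: "norm (?f s x) \<le> M s" for s x
  proof -
    have "norm (?f s x) = 1 / (\<sigma>\<^sup>2) ^ d * (real ((d + s) choose s) * norm (G (zt x) (wt x) / (zt x * wt x)) ^ s)"
      unfolding factor norm_mult[of "1 / _"] norm_divide[of 1] norm_power[of "zt x * wt x"] norm_mult[of "zt x"] norm_zt_wt
      by (simp add: norm_mult norm_power power2_eq_square)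
    also have "\<dots> \<le> 1 / (\<sigma>\<^sup>2) ^ d * (2 ^ (d + s) * (1 / 8) ^ s)"
    proof (intro mult_left_mono mult_mono power_mono ratio)
      show "real ((d + s) choose s) \<le> 2 ^ (d + s)"
        using binomial_le_pow2[of "d + s" s] by (metis of_nat_le_iff of_nat_numeral of_nat_power)
    qed auto
    finally show ?thesis
      by (simp add: M_def)
  qed
  have sM: "summable M"
  proof -
    have "M s = 2 ^ d / (\<sigma>\<^sup>2) ^ d * (1 / 4) ^ s" for s
    proof -
      have "(1 / 4 :: real) ^ s = 2 ^ s * (1 / 8) ^ s"
        by (simp flip: power_mult_distrib)
      then show ?thesis
        by (simp add: M_def power_add)
    qed
    then have "M = (\<lambda>s. 2 ^ d / (\<sigma>\<^sup>2) ^ d * (1 / 4) ^ s)"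
      by (rule ext)
    then show ?thesis
      by (simp add: summable_mult summable_geometric)
  qed
  have "((\<lambda>s. integral torus (?f s)) has_sum
      integral torus (\<lambda>x. (of_real \<sigma> * cis (snd x))\<^sup>2 / P_torus x ^ (d + 1))) UNIV"
  proof (rule integral_has_sum[where M = M])
    have "continuous_on torus (\<lambda>x. P_torus x - (of_real \<sigma> * cis (snd x))\<^sup>2)"
      by (intro continuous_intros continuous_on_P_torus)
    then have "continuous_on torus (\<lambda>x. G (zt x) (wt x))"
      by (simp only: P_def add_diff_cancel_left')
    then show "continuous_on torus (?f s)" for s
      using A0 by (intro continuous_intros) auto
    show "norm (?f s x) \<le> M s" for s x
      by (rule bound)
    show "M summable_on UNIV"
    proof (rule norm_summable_imp_summable_on)
      have "norm (M s) = M s" for s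
        by (simp add: M_def)
      then show "summable (\<lambda>s. norm (M s))"
        using sM by simp
    qed
    show "((\<lambda>s. ?f s x) has_sum (of_real \<sigma> * cis (snd x))\<^sup>2 / P_torus x ^ (d + 1)) UNIV" for x
    proof (rule norm_summable_imp_has_sum)
      show "summable (\<lambda>s. norm (?f s x))"
        by (rule summable_comparison_test[OF _ sM]) (use bound in simp)
      have "norm (G (zt x) (wt x) / (zt x * wt x)) < 1"
        using ratio[of x] by simp
      from sums_mult[OF negative_binomial_sums[OF this, of d], of "1 / (zt x * wt x) ^ d"]
      have "(\<lambda>s. ?f s x) sums (1 / (zt x * wt x) ^ d * (1 / (1 + G (zt x) (wt x) / (zt x * wt x)) ^ (d + 1)))"
        unfolding factor .
      also have "1 / (zt x * wt x) ^ d * (1 / (1 + G (zt x) (wt x) / (zt x * wt x)) ^ (d + 1)) =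
          zt x * wt x / (zt x * wt x * (1 + G (zt x) (wt x) / (zt x * wt x))) ^ (d + 1)"
        using A0[of x] by (simp add: power_mult_distrib)
      also have "zt x * wt x * (1 + G (zt x) (wt x) / (zt x * wt x)) = P_torus x"
        unfolding P_eq using A0[of x] by (simp add: distrib_left)
      finally show "(\<lambda>s. ?f s x) sums ((of_real \<sigma> * cis (snd x))\<^sup>2 / P_torus x ^ (d + 1))"
        unfolding zt_wt .
    qed
  qed
  moreover have "integral torus (?f s) = (-1) ^ s * of_nat ((d + s) choose s) * (of_real (4 * pi\<^sup>2) * tuple_sum d s)" for s
    unfolding integral_mult_right integral_G_power by simp
  ultimately have int: "((\<lambda>s. (-1) ^ s * of_nat ((d + s) choose s) * (of_real (4 * pi\<^sup>2) * tuple_sum d s)) has_sum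
      integral torus (\<lambda>x. (of_real \<sigma> * cis (snd x))\<^sup>2 / P_torus x ^ (d + 1))) UNIV"
    by simp
  have "((\<lambda>s. (-1) ^ s * of_nat ((d + s) choose s) * (of_real (4 * pi\<^sup>2) * tuple_sum d s)) has_sum
      of_real (4 * pi\<^sup>2) * (\<Sum>s\<le>2 * d. (-1) ^ s * of_nat ((d + s) choose s) * tuple_sum d s)) UNIV"
    by (rule has_sum_finite_neutralI[of "{..2 * d}"])
      (auto simp: tuple_sum_def index_tuples_empty sum_distrib_left mult_ac)
  from has_sum_unique[OF int this] show ?thesis
    by (simp add: mean_coeff_def)
qed

lemma mean_coeff_0: "mean_coeff 0 = 1"
proof -
  have "index_tuples 0 0 = {[]}"
    by (auto simp: index_tuples_def zero_prod_def)
  then show ?thesis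
    by (simp add: mean_coeff_eq tuple_sum_def)
qed

lemma mean_coeff_pos_degree:
  assumes "d \<ge> 1"
  shows "mean_coeff d = - of_nat (d + 1) *
    (\<Sum>s = 1..2 * d. (-1) ^ (s - 1) * fact (d + s) / (fact s * fact (d + 1)) * tuple_sum d s)"
proof -
  \<comment> \<open>The empty list sums to \<open>(0, 0)\<close>, so \<open>s = 0\<close>
    contributes only when \<open>d = 0\<close>.\<close>
  have "index_tuples d 0 = {}"
    using assms by (auto simp: index_tuples_def zero_prod_def)
  then have "mean_coeff d = (\<Sum>s = 1..2 * d. (-1) ^ s * of_nat ((d + s) choose s) * tuple_sum d s)"
    by (simp add: mean_coeff_eq atMost_atLeast0 sum.atLeast_Suc_atMost tuple_sum_def)
  also have "\<dots> = (\<Sum>s = 1..2 * d. - of_nat (d + 1) *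
      ((-1) ^ (s - 1) * fact (d + s) / (fact s * fact (d + 1)) * tuple_sum d s))"
  proof (rule sum.cong[OF refl])
    fix s assume "s \<in> {1..2 * d}"
    then have sgn: "(-1) ^ s = - ((-1) ^ (s - 1) :: complex)"
      by (cases s) auto
    have "of_nat ((d + s) choose s) = (fact (d + s) / (fact s * fact d) :: complex)"
      by (simp add: binomial_fact)
    also have "\<dots> = of_nat (d + 1) * (fact (d + s) / (fact s * fact (d + 1)))"
    proof -
      have "fact (d + 1) = of_nat (d + 1) * (fact d :: complex)" "of_nat (d + 1) \<noteq> (0 :: complex)"
        by (simp_all del: of_nat_Suc of_nat_add)
      then show ?thesis
        by (simp del: of_nat_Suc of_nat_add fact_Suc)
    qed
    finally have "of_nat ((d + s) choose s) = of_nat (d + 1) * (fact (d + s) / (fact s * fact (d + 1)) :: complex)" .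
    then show "(-1) ^ s * of_nat ((d + s) choose s) * tuple_sum d s = - of_nat (d + 1) *
        ((-1) ^ (s - 1) * fact (d + s) / (fact s * fact (d + 1)) * tuple_sum d s)"
      unfolding sgn by (simp only: mult_minus_left mult_minus_right times_divide_eq_right mult_ac)
  qed
  finally show ?thesis
    by (simp only: sum_distrib_left)
qed

section \<open>Constancy and limit of the period function\<close>

lemma period_constant_iff:
  assumes "0 < \<epsilon>" "\<epsilon> \<le> e0"
  shows "(\<forall>e. 0 < e \<and> e < \<epsilon> \<longrightarrow> period e = 1) \<longleftrightarrow> (\<forall>d\<ge>1. mean_coeff d = 0)"
proof safe
  fix e assume *: "\<forall>d\<ge>1. mean_coeff d = 0" "0 < e" "e < \<epsilon>"
  have "((\<lambda>d. mean_coeff d * of_real e ^ d) has_sum 1) UNIV"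
    by (rule has_sum_finite_neutralI[of "{0}"]) (use *(1) in \<open>auto simp: mean_coeff_0\<close>)
  moreover have "((\<lambda>d. mean_coeff d * of_real e ^ d) has_sum of_real (period e)) UNIV"
    using * assms by (intro period_has_sum) auto
  ultimately have "of_real (period e) = (1 :: complex)"
    using has_sum_unique by blast
  then show "period e = 1"
    by simp
next
  fix d :: nat assume *: "\<forall>e. 0 < e \<and> e < \<epsilon> \<longrightarrow> period e = 1" and d: "1 \<le> d"
  \<comment> \<open>Clearing the constant coefficient gives the series of
    \<open>period e - 1\<close>, which vanishes at the centre; a nonzero coefficient of positive
    index then makes 0 an isolated zero.\<close>
  define a where "a d = (if d = 0 then 0 else mean_coeff d)" for d
  define f where "f x = (\<Sum>d. a d * x ^ d)" for x
  have a_eq: "a d * x ^ d = mean_coeff d * x ^ d - (if d = 0 then 1 else 0)" for d x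
    by (simp add: a_def mean_coeff_0)
  have sums: "(\<lambda>d. a d * of_real e ^ d) sums 0" if "0 < e" "e < \<epsilon>" for e
  proof -
    have "(\<lambda>d. mean_coeff d * of_real e ^ d) sums of_real (period e)"
      using that assms by (intro has_sum_imp_sums period_has_sum) auto
    then have "(\<lambda>d. mean_coeff d * of_real e ^ d - (if d = 0 then 1 else 0)) sums (of_real (period e) - 1)"
      using sums_single[of 0 "\<lambda>_. 1 :: complex"] by (intro sums_diff) auto
    then show ?thesis
      using * that by (simp add: a_eq)
  qed
  show "mean_coeff d = 0"
  proof (rule ccontr)
    assume "mean_coeff d \<noteq> 0"
    have f: "(\<lambda>d. a d * (x - 0) ^ d) sums f x" if "norm (x - 0) < \<epsilon> / 2" for x
    proof -
      have "summable (\<lambda>d. a d * x ^ d)"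
        using powser_inside[OF sums_summable[OF sums[of "\<epsilon> / 2"]], of x] that assms by simp
      then show ?thesis
        unfolding f_def by (simp add: summable_sums)
    qed
    have f0: "f 0 = 0"
      by (simp add: f_def a_def)
    obtain s where s: "0 < s" "\<And>z. z \<in> cball 0 s - {0} \<Longrightarrow> f z \<noteq> 0"
      using powser_0_nonzero[of "\<epsilon> / 2" 0 a f d] f f0 \<open>mean_coeff d \<noteq> 0\<close> d assms by (auto simp: a_def)
    define e where "e = min s (\<epsilon> / 2)"
    have "f (of_real e) = 0"
      unfolding f_def using sums[of e] s(1) assms by (intro sums_unique[symmetric]) (auto simp: e_def)
    moreover have "of_real e \<in> cball (0 :: complex) s - {0}"
      using s(1) assms by (auto simp: e_def)
    ultimately show False
      using s(2) by blast
  qed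
qed

text \<open>The margin \<open>1 / 2\<close> suffices: between \<open>1 / 2\<close> and
  \<open>3 / 2\<close>, the number 1 is the only value having 1 as an integer multiple.\<close>

lemma period_tendsto: "\<exists>\<epsilon>>0. \<epsilon> \<le> e0 \<and> (\<forall>e. 0 < e \<and> e < \<epsilon> \<longrightarrow> \<bar>period e - 1\<bar> < 1 / 2)"
proof -
  define f where "f x = (\<Sum>d. mean_coeff d * x ^ d)" for x
  have sum: "(\<lambda>d. mean_coeff d * of_real e ^ d) sums of_real (period e)" if "0 < e" "e < e0" for e
    using that by (intro has_sum_imp_sums period_has_sum)
  have "summable (\<lambda>d. mean_coeff d * of_real (e0 / 2) ^ d)"
    using sum[of "e0 / 2"] e0_pos by (auto simp: sums_iff)
  then have "isCont f 0"
    unfolding f_def by (rule isCont_powser) (use e0_pos in simp)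
  moreover have "f 0 = 1"
    by (simp add: f_def mean_coeff_0)
  ultimately obtain s where s: "s > 0" "\<And>x. norm x < s \<Longrightarrow> norm (f x - 1) < 1 / 2"
    unfolding continuous_at_eps_delta by (metis dist_norm diff_zero half_gt_zero_iff zero_less_one)
  show ?thesis
  proof (intro exI[of _ "min s e0"] conjI allI impI)
    fix e assume e: "0 < e \<and> e < min s e0"
    then have "f (of_real e) = of_real (period e)"
      unfolding f_def using sum[of e] by (auto simp: sums_iff)
    moreover have "norm (f (of_real e) - 1) < 1 / 2"
      using e by (intro s(2)) auto
    ultimately have "norm (of_real (period e - 1) :: complex) < 1 / 2"
      by simp
    then show "\<bar>period e - 1\<bar> < 1 / 2"
      unfolding norm_of_real .
  qed (use s e0_pos in auto)
qed

end

section \<open>Quadrature on the circle and angular lifts\<close>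

text \<open>\<open>Q\<close> is elapsed time as a function of the angle, and its inverse is the
  motion. Each turn adds the same positive amount, so \<open>Q\<close> is unbounded in both
  directions and the motion is defined for all times.\<close>

lemma periodic_quadrature:
  fixes f :: "real \<Rightarrow> real"
  assumes cont: "continuous_on UNIV f" and pos: "\<And>x. f x > 0" and per: "\<And>x. f (x + 2 * pi) = f x"
  obtains Q where "\<And>x. (Q has_real_derivative f x) (at x)"
    "\<And>x. Q (x + 2 * pi) = Q x + integral {0..2 * pi} f"
    "bij Q" "\<And>y. (inv Q has_real_derivative 1 / f (inv Q y)) (at y)"
proof -
  have "isCont f x" for x
    using cont by (simp add: continuous_on_eq_continuous_at)
  then obtain Q where "\<forall>x. - \<infinity> < ereal x \<longrightarrow> ereal x < \<infinity> \<longrightarrow> (Q has_vector_derivative f x) (at x)"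
    using einterval_antiderivative[of "- \<infinity>" \<infinity> f] by auto
  then have Q: "(Q has_real_derivative f x) (at x)" for x
    by (simp add: has_real_derivative_iff_has_vector_derivative)
  have contQ: "continuous_on S Q" for S
    by (rule DERIV_continuous_on[OF has_field_derivative_at_within[OF Q]])
  have mono: "Q x < Q y" if "x < y" for x y
    using that Q pos by (intro DERIV_pos_imp_increasing[OF that]) blast
  have shift: "Q (x + 2 * pi) = Q x + integral {0..2 * pi} f" for x
  proof -
    have "((\<lambda>x. Q (x + 2 * pi)) has_real_derivative f (x + 2 * pi) * 1) (at x)" for x
      by (rule DERIV_chain2[OF Q]) (auto intro!: derivative_eq_intros)
    then have "((\<lambda>x. Q (x + 2 * pi) - Q x) has_real_derivative f x - f x) (at x)" for x
      unfolding mult_1_right per by (intro DERIV_diff Q)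
    then have "Q (x + 2 * pi) - Q x = Q (0 + 2 * pi) - Q 0"
      by (intro DERIV_isconst_all) simp
    moreover have "(f has_integral Q (2 * pi) - Q 0) {0..2 * pi}"
      using Q by (intro fundamental_theorem_of_calculus)
        (auto simp: has_real_derivative_iff_has_vector_derivative[symmetric] intro: has_field_derivative_at_within)
    ultimately show ?thesis
      by (simp add: integral_unique)
  qed
  define T where "T = integral {0..2 * pi} f"
  have T: "T > 0"
    using mono[of 0 "2 * pi"] shift[of 0] by (simp add: T_def)
  have shift_n: "Q (2 * pi * real n) = Q 0 + real n * T" "Q (- 2 * pi * real n) = Q 0 - real n * T" for n
  proof (induction n)
    case (Suc n)
    show "Q (2 * pi * real (Suc n)) = Q 0 + real (Suc n) * T"
      using shift[of "2 * pi * real n"] Suc by (simp add: T_def algebra_simps)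
    show "Q (- 2 * pi * real (Suc n)) = Q 0 - real (Suc n) * T"
      using shift[of "- 2 * pi * real (Suc n)"] Suc by (simp add: T_def algebra_simps)
  qed auto
  have inj: "inj Q"
    using mono by (metis injI linorder_neqE less_irrefl)
  have "\<exists>x. Q x = y" for y
  proof -
    obtain n where n: "\<bar>y - Q 0\<bar> < real n * T"
      using ex_less_of_nat_mult[OF T] by blast
    have "\<exists>x\<ge>- 2 * pi * real n. x \<le> 2 * pi * real n \<and> Q x = y"
      by (rule IVT') (use n shift_n[of n] contQ in auto)
    then show ?thesis
      by blast
  qed
  then have bij: "bij Q"
    using inj unfolding bij_def surj_def by metis
  have Q_inv: "Q (inv Q y) = y" for y
    using bij by (simp add: bij_is_surj surj_f_inv_f)
  have "(inv Q has_real_derivative 1 / f (inv Q y)) (at y)" for y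
  proof -
    have "(inv Q has_derivative (*) (1 / f (inv Q y))) (at y)"
    proof (rule has_derivative_inverse_strong_x[of UNIV _ _ Q])
      show "(Q has_derivative (*) (f (inv Q y))) (at (inv Q y))"
        using Q by (simp add: has_field_derivative_def)
      show "continuous_on UNIV Q"
        by (rule contQ)
      show "(*) (f (inv Q y)) \<circ> (*) (1 / f (inv Q y)) = id"
        using pos[of "inv Q y"] by (auto simp: fun_eq_iff)
    qed (use inj Q_inv in auto)
    then show ?thesis
      by (simp add: has_field_derivative_def)
  qed
  then show ?thesis
    using that Q shift bij by blast
qed

text \<open>A continuous argument without choosing branches: for a primitive \<open>L\<close> of
  \<open>z' / z\<close> the product \<open>z * exp (- L)\<close> is constant, and a logarithm of
  that constant fixes the initial angle.\<close>

lemma angle_lift: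
  fixes z z' :: "real \<Rightarrow> complex"
  assumes "\<And>t. (z has_vector_derivative z' t) (at t)" "\<And>t. z t \<noteq> 0" "continuous_on UNIV z'"
  obtains \<theta> where "\<And>t. z t = of_real (norm (z t)) * cis (\<theta> t)"
    "\<And>t. (\<theta> has_real_derivative Im (z' t / z t)) (at t)"
proof -
  have "continuous_on UNIV z"
    using assms(1) has_vector_derivative_continuous by (metis continuous_at_imp_continuous_on)
  then have "continuous_on UNIV (\<lambda>t. z' t / z t)"
    using assms by (intro continuous_intros) auto
  then have "isCont (\<lambda>t. z' t / z t) t" for t
    by (simp add: continuous_on_eq_continuous_at)
  then obtain L where "\<forall>t. - \<infinity> < ereal t \<longrightarrow> ereal t < \<infinity> \<longrightarrow> (L has_vector_derivative z' t / z t) (at t)"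
    using einterval_antiderivative[of "- \<infinity>" \<infinity> "\<lambda>t. z' t / z t"] by auto
  then have L: "(L has_vector_derivative z' t / z t) (at t)" for t
    by simp
  have "((\<lambda>t. z t * exp (- L t)) has_vector_derivative 0) (at t)" for t
  proof -
    have "((\<lambda>t. exp (- L t)) has_vector_derivative - (z' t / z t) * exp (- L t)) (at t)"
      using field_vector_diff_chain_at[OF has_vector_derivative_minus[OF L] DERIV_exp] by (simp add: o_def)
    from has_vector_derivative_mult[OF assms(1) this] show ?thesis
      using assms(2)[of t] by (simp add: field_simps)
  qed
  then have const: "z t * exp (- L t) = z 0 * exp (- L 0)" for t
    using has_derivative_zero_unique[of UNIV "\<lambda>t. z t * exp (- L t)" t 0]
    by (simp add: has_vector_derivative_def)
  obtain a where a: "z 0 * exp (- L 0) = exp a"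
    using assms(2)[of 0] by (metis exp_Ln exp_not_eq_zero mult_eq_0_iff)
  have z_exp: "z t = exp (L t + a)" for t
    using const[of t] unfolding a by (simp add: exp_add exp_minus field_simps)
  show ?thesis
  proof (rule that[of "\<lambda>t. Im (L t + a)"])
    show "z t = of_real (norm (z t)) * cis (Im (L t + a))" for t
      unfolding z_exp norm_exp_eq_Re by (simp add: exp_eq_polar)
    show "((\<lambda>t. Im (L t + a)) has_real_derivative Im (z' t / z t)) (at t)" for t
    proof -
      have "((\<lambda>t. L t + a) has_derivative (\<lambda>h. h *\<^sub>R (z' t / z t))) (at t)"
        using L[of t] by (simp add: has_vector_derivative_def has_derivative_add_const)
      then have "((\<lambda>t. Im (L t + a)) has_derivative (\<lambda>h. Im (h *\<^sub>R (z' t / z t)))) (at t)"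
        by (rule has_derivative_Im)
      then show ?thesis
        by (simp add: has_field_derivative_def mult_commute_abs)
    qed
  qed
qed

section \<open>The flow\<close>

context real_cubic_series
begin

text \<open>\<open>energy\<close> is \<open>H / (2 * pi)\<close> in the coordinate \<open>z\<close>, in which Hamilton's equations are \<open>z' = vfield z\<close>.\<close>

definition energy :: "complex \<Rightarrow> real" where
  "energy z = Re (z * cnj z + G z (cnj z))"

definition vfield :: "complex \<Rightarrow> complex" where
  "vfield z = - (2 * pi * \<i>) * hgrad z"

lemma energy_polar: "energy (of_real r * cis \<theta>) = p r \<theta>"
proof -
  have "of_real r * cis \<theta> * (of_real r * cis (- \<theta>)) = (of_real r)\<^sup>2 * (cis \<theta> * cis (- \<theta>))"
    by (simp only: power2_eq_square mult_ac)
  then show ?thesis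
    unfolding energy_def p_def P_def by (simp add: cis_cnj cis_mult)
qed

lemma energy_bounds:
  assumes "norm z \<le> \<delta>"
  shows "7 / 8 * (norm z)\<^sup>2 \<le> energy z" "energy z \<le> 9 / 8 * (norm z)\<^sup>2"
proof -
  have "z = of_real (norm z) * cis (Arg z)"
    using rcis_cmod_Arg[of z] by (simp add: rcis_def)
  then have "energy z = p (norm z) (Arg z)"
    by (metis energy_polar)
  then show "7 / 8 * (norm z)\<^sup>2 \<le> energy z" "energy z \<le> 9 / 8 * (norm z)\<^sup>2"
    using p_bounds(1,2)[of "norm z" "Arg z"] assms by simp_all
qed

lemma continuous_on_G_diag: "continuous_on (cball 0 \<delta>) (\<lambda>z. G z (cnj z))"
  and continuous_on_vfield: "continuous_on (cball 0 \<delta>) vfield"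
proof -
  have c: "continuous_on (cball 0 \<delta>) (\<lambda>z. (z, cnj z))"
    by (intro continuous_intros)
  have s: "(\<lambda>z. (z, cnj z)) ` cball 0 \<delta> \<subseteq> bidisc"
    using delta_less_rho by auto
  show "continuous_on (cball 0 \<delta>) (\<lambda>z. G z (cnj z))"
    using continuous_on_compose2[OF continuous_on_G c s] by simp
  have "continuous_on (cball 0 \<delta>) (\<lambda>z. G2 z (cnj z))"
    using continuous_on_compose2[OF continuous_on_G12(2) c s] by simp
  then show "continuous_on (cball 0 \<delta>) vfield"
    unfolding vfield_def hgrad_def by (intro continuous_intros)
qed

lemma energy_has_derivative:
  assumes "norm z < \<delta>"
  shows "(energy has_derivative (\<lambda>h. 2 * Re (cnj (hgrad z) * h))) (at z)"
proof -
  have cnj: "(cnj has_derivative cnj) (at z)"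
    by (rule bounded_linear_imp_has_derivative[OF bounded_linear_cnj])
  have "((\<lambda>z. z * cnj z + G z (cnj z)) has_derivative
      (\<lambda>h. (z * cnj h + h * cnj z) + (G1 z (cnj z) * h + G2 z (cnj z) * cnj h))) (at z)"
    by (intro has_derivative_add has_derivative_mult has_derivative_ident cnj G_comp_has_derivative)
      (use assms delta_less_rho in auto)
  then have "(energy has_derivative
      (\<lambda>h. Re ((z * cnj h + h * cnj z) + (G1 z (cnj z) * h + G2 z (cnj z) * cnj h)))) (at z)"
    unfolding energy_def[abs_def] by (rule has_derivative_Re)
  moreover have "Re ((z * cnj h + h * cnj z) + (G1 z (cnj z) * h + G2 z (cnj z) * cnj h)) =
      2 * Re (cnj (hgrad z) * h)" for h
    using G2_cnj[of z] assms delta_less_rho by (simp add: hgrad_def algebra_simps)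
  ultimately show ?thesis
    by simp
qed

text \<open>\<open>vfield z\<close> is a negative imaginary multiple of \<open>hgrad z\<close>, that
  is, the gradient turned by a right angle.\<close>

lemma energy_along_flow:
  assumes "norm (z t) < \<delta>" "(z has_vector_derivative vfield (z t)) (at t)"
  shows "((\<lambda>t. energy (z t)) has_real_derivative 0) (at t)"
proof -
  have "((\<lambda>t. energy (z t)) has_derivative (\<lambda>h. 2 * Re (cnj (hgrad (z t)) * (h *\<^sub>R vfield (z t))))) (at t)"
    by (rule has_derivative_compose[OF assms(2)[unfolded has_vector_derivative_def] energy_has_derivative[OF assms(1)]])
  moreover have "2 * Re (cnj (hgrad (z t)) * (h *\<^sub>R vfield (z t))) = 0 * h" for h
    by (simp add: vfield_def algebra_simps)
  ultimately show ?thesis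
    by (simp only: has_field_derivative_def)
qed

lemma vfield_polar:
  assumes "\<bar>r\<bar> < \<rho> / 2" "r \<noteq> 0"
  shows "Im (vfield (of_real r * cis \<theta>) / (of_real r * cis \<theta>)) = - pi * p' r \<theta> / r"
proof -
  have "vfield (of_real r * cis \<theta>) / (of_real r * cis \<theta>) =
      - (2 * pi * \<i>) * (cis (- \<theta>) * hgrad (of_real r * cis \<theta>)) / of_real r"
    by (simp add: vfield_def cis_inverse divide_inverse mult_ac)
  then show ?thesis
    using P'_real[OF assms(1), of \<theta>] by (simp add: p'_def)
qed

section \<open>Orbits near the origin\<close>

lemma quadrature:
  assumes "0 < e" "e < e0"
  obtains Q where "\<And>x. (Q has_real_derivative q e x / pi) (at x)"
    "\<And>x. Q (x + 2 * pi) = Q x + period e"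
    "bij Q" "\<And>y. (inv Q has_real_derivative pi / q e (inv Q y)) (at y)"
proof -
  have "continuous_on UNIV (\<lambda>x. q e x / pi)"
    by (intro continuous_intros continuous_on_q assms) simp
  moreover have "q e x / pi > 0" "q e (x + 2 * pi) / pi = q e x / pi" for x
    using q_pos[OF assms] by (simp_all add: q_periodic)
  ultimately obtain Q where "\<And>x. (Q has_real_derivative q e x / pi) (at x)"
    "\<And>x. Q (x + 2 * pi) = Q x + integral {0..2 * pi} (\<lambda>x. q e x / pi)"
    "bij Q" "\<And>y. (inv Q has_real_derivative 1 / (q e (inv Q y) / pi)) (at y)"
    using periodic_quadrature[of "\<lambda>x. q e x / pi"] by metis
  then show ?thesis
    using that[of Q] by (simp add: period_def)
qed

text \<open>The differential equation is available only while the curve is in the disc of radius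
  \<delta>, so its staying there has to be a conclusion. The good times form an open set, as energy
  is locally conserved, and a closed set, as conserved energy forces the curve into the smaller
  closed disc of radius \<sigma>.\<close>

lemma confined:
  assumes cont: "continuous_on UNIV z" and small: "norm (z 0) < \<delta>" "energy (z 0) < e0"
    and flow: "\<And>t. norm (z t) < \<delta> \<Longrightarrow> (z has_vector_derivative vfield (z t)) (at t)"
  shows "norm (z t) < \<delta>" "energy (z t) = energy (z 0)"
proof -
  define S where "S = {t. norm (z t) < \<delta> \<and> energy (z t) = energy (z 0)}"
  define S' where "S' = {t. z t \<in> cball 0 \<sigma>}"
  \<comment> \<open>Energy below \<open>\<delta>\<^sup>2 / 4\<close> gives
    \<open>(norm w)\<^sup>2 < 2 / 7 * \<delta>\<^sup>2\<close>, a gap between the orbit and the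
    boundary of the disc.\<close>
  have inS': "norm w \<le> \<sigma>" if "norm w < \<delta>" "energy w = energy (z 0)" for w
  proof (rule power2_le_imp_le)
    show "(norm w)\<^sup>2 \<le> \<sigma>\<^sup>2"
    proof -
      have "\<sigma>\<^sup>2 = 9 / 16 * \<delta>\<^sup>2"
        by (simp add: \<sigma>_def power_mult_distrib power_divide)
      moreover have "7 / 8 * (norm w)\<^sup>2 \<le> energy (z 0)" "energy (z 0) < \<delta>\<^sup>2 / 4"
        using energy_bounds(1)[of w] that small by (simp_all add: e0_def)
      ultimately show ?thesis
        using zero_le_power2[of \<delta>] by linarith
    qed
  qed (use sigma_pos in simp)
  have S_eq: "S = {t \<in> S'. energy (z t) = energy (z 0)}"
    using inS' sigma_less by (auto simp: S_def S'_def)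
  have "closed S'"
  proof -
    have "S' = {t. norm (z t) \<le> \<sigma>}"
      by (auto simp: S'_def)
    then show ?thesis
      by (simp only:) (intro closed_Collect_le continuous_intros cont)
  qed
  moreover have "continuous_on S' (\<lambda>t. energy (z t))"
  proof -
    have "continuous_on (cball 0 \<delta>) energy"
      unfolding energy_def by (intro continuous_intros continuous_on_G_diag)
    moreover have "continuous_on S' z"
      by (rule continuous_on_subset[OF cont]) simp
    ultimately show ?thesis
      by (rule continuous_on_compose2) (use sigma_less in \<open>auto simp: S'_def\<close>)
  qed
  ultimately have "closed S"
    unfolding S_eq by (intro continuous_closed_preimage_constant)
  moreover have "open S"
    unfolding open_contains_ball
  proof
    fix s assume s: "s \<in> S"
    have "open {t. norm (z t) < \<delta>}"
      by (intro open_Collect_less continuous_intros cont)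
    then obtain d where d: "d > 0" "ball s d \<subseteq> {t. norm (z t) < \<delta>}"
      using s by (auto simp: S_def open_contains_ball)
    have "((\<lambda>t. energy (z t)) has_field_derivative 0) (at x within ball s d)" if "x \<in> ball s d" for x
    proof -
      have "norm (z x) < \<delta>"
        using d that by auto
      then show ?thesis
        by (intro has_field_derivative_at_within[OF energy_along_flow[OF _ flow]])
    qed
    then obtain k where "\<forall>x\<in>ball s d. energy (z x) = k"
      using has_field_derivative_zero_constant[of "ball s d" "\<lambda>t. energy (z t)"] by auto
    then have "ball s d \<subseteq> S"
      using d s by (auto simp: S_def)
    then show "\<exists>d>0. ball s d \<subseteq> S"
      using d(1) by blast
  qed
  moreover have "0 \<in> S"
    using small by (simp add: S_def)
  ultimately have "S = UNIV"
    using clopen[of S] by auto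
  then show "norm (z t) < \<delta>" "energy (z t) = energy (z 0)"
    by (auto simp: S_def)
qed

text \<open>The conserved energy determines the radius from the angle, which reduces the planar
  system to an autonomous scalar equation. Orbits run clockwise.\<close>

lemma solution_angle:
  assumes "\<And>t. norm (z t) < \<delta>" "\<And>t. (z has_vector_derivative vfield (z t)) (at t)"
    and "\<And>t. energy (z t) = e" "0 < e" "e < e0"
  obtains \<theta> where "\<And>t. z t = of_real (R e (\<theta> t)) * cis (\<theta> t)"
    "\<And>t. (\<theta> has_real_derivative - pi / q e (\<theta> t)) (at t)"
proof -
  have nz: "z t \<noteq> 0" for t
    using energy_bounds(2)[of "z t"] assms(3)[of t] assms(1)[of t] \<open>0 < e\<close> by auto
  have "continuous_on UNIV z"
    using assms(2) has_vector_derivative_continuous by (metis continuous_at_imp_continuous_on)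
  then have "continuous_on UNIV (\<lambda>t. vfield (z t))"
    by (rule continuous_on_compose2[OF continuous_on_vfield]) (use assms(1) in \<open>auto simp: less_imp_le\<close>)
  then obtain \<theta> where \<theta>: "\<And>t. z t = of_real (norm (z t)) * cis (\<theta> t)"
    "\<And>t. (\<theta> has_real_derivative Im (vfield (z t) / z t)) (at t)"
    using angle_lift[OF assms(2) nz] by blast
  have R_eq: "R e (\<theta> t) = norm (z t)" for t
  proof (rule R_eqI)
    show "p (norm (z t)) (\<theta> t) = e"
      using assms(3)[of t] \<theta>(1)[of t] energy_polar by metis
  qed (use nz assms in auto)
  have "Im (vfield (z t) / z t) = - pi / q e (\<theta> t)" for t
  proof -
    have "Im (vfield (z t) / z t) = - pi * p' (norm (z t)) (\<theta> t) / norm (z t)"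
      using vfield_polar[of "norm (z t)" "\<theta> t"] nz[of t] assms(1)[of t] delta_less_rho
      unfolding \<theta>(1)[of t, symmetric] by simp
    then show ?thesis
      by (simp add: q_def R_eq)
  qed
  then show ?thesis
    using that[of \<theta>] \<theta> by (simp add: R_eq)
qed

text \<open>Separation of variables. It holds for every solution and thus plays the part of
  uniqueness.\<close>

lemma solution_quadrature:
  assumes Q: "\<And>x. (Q has_real_derivative q e x / pi) (at x)"
    and \<theta>: "\<And>t. (\<theta> has_real_derivative - pi / q e (\<theta> t)) (at t)" and e: "0 < e" "e < e0"
  shows "Q (\<theta> t) = Q (\<theta> s) - (t - s)"
proof -
  have "((\<lambda>t. Q (\<theta> t) + t) has_real_derivative 0) (at t)" for t
  proof -
    have "((\<lambda>t. Q (\<theta> t) + t) has_real_derivative q e (\<theta> t) / pi * (- pi / q e (\<theta> t)) + 1) (at t)"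
      by (intro DERIV_add DERIV_chain2[OF Q \<theta>] DERIV_ident)
    then show ?thesis
      using q_pos[OF e, of "\<theta> t"] by simp
  qed
  then have "Q (\<theta> t) + t = Q (\<theta> s) + s"
    by (intro DERIV_isconst_all) simp
  then show ?thesis
    by simp
qed

lemma solution_periodic:
  assumes "\<And>t. norm (z t) < \<delta>" "\<And>t. (z has_vector_derivative vfield (z t)) (at t)"
    and "\<And>t. energy (z t) = e" "0 < e" "e < e0" "period e = 1"
  shows "z (t + 1) = z t"
proof -
  obtain \<theta> where \<theta>: "\<And>t. z t = of_real (R e (\<theta> t)) * cis (\<theta> t)"
    "\<And>t. (\<theta> has_real_derivative - pi / q e (\<theta> t)) (at t)"
    by (rule solution_angle[OF assms(1-5)]) (rule that)
  obtain Q where Q: "\<And>x. (Q has_real_derivative q e x / pi) (at x)"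
    "\<And>x. Q (x + 2 * pi) = Q x + period e" "bij Q"
    by (rule quadrature[OF assms(4,5)]) (rule that)
  have "Q (\<theta> (t + 1) + 2 * pi) = Q (\<theta> t)"
    using solution_quadrature[OF Q(1) \<theta>(2) assms(4,5), of "t + 1" t] Q(2) assms(6) by simp
  then have shift: "\<theta> t = \<theta> (t + 1) + 2 * pi"
    using Q(3) by (simp add: bij_def inj_eq)
  have "cis (\<theta> (t + 1) + 2 * pi) = cis (\<theta> (t + 1))"
    by (simp add: complex_eq_iff)
  then show ?thesis
    unfolding \<theta>(1) shift R_periodic by simp
qed

text \<open>Returning to the same point changes the angle by a multiple \<open>k\<close> of a full
  turn, and \<open>Q\<close> converts \<open>k\<close> turns into the time
  \<open>k * period e\<close>. The number of turns within unit time is not yet known.\<close>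

lemma return_time_multiple_of_period:
  assumes "\<And>t. norm (z t) < \<delta>" "\<And>t. (z has_vector_derivative vfield (z t)) (at t)"
    and "\<And>t. energy (z t) = e" "0 < e" "e < e0" "z 1 = z 0"
  shows "\<exists>k::int. of_int k * period e = 1"
proof -
  obtain \<theta> where \<theta>: "\<And>t. z t = of_real (R e (\<theta> t)) * cis (\<theta> t)"
    "\<And>t. (\<theta> has_real_derivative - pi / q e (\<theta> t)) (at t)"
    by (rule solution_angle[OF assms(1-5)]) (rule that)
  obtain Q where Q: "\<And>x. (Q has_real_derivative q e x / pi) (at x)"
    "\<And>x. Q (x + 2 * pi) = Q x + period e"
    by (rule quadrature[OF assms(4,5)]) (rule that)
  have "norm (z t) = R e (\<theta> t)" for t
    unfolding \<theta>(1)[of t] using R(1)[OF assms(4,5), of "\<theta> t"] by (simp add: norm_mult)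
  then have "R e (\<theta> 1) = R e (\<theta> 0)"
    using assms(6) by metis
  then have "cis (\<theta> 0) = cis (\<theta> 1)"
    using \<theta>(1)[of 1] \<theta>(1)[of 0] assms(6) R(1)[OF assms(4,5), of "\<theta> 0"] by simp
  then obtain k :: int where k: "\<theta> 0 = \<theta> 1 + 2 * pi * of_int k"
    using sin_cos_eq_iff[of "\<theta> 0" "\<theta> 1"] by (auto simp: complex_eq_iff)
  have nat: "Q (x + 2 * pi * real n) = Q x + real n * period e" for x n
  proof (induction n)
    case (Suc n)
    then show ?case
      using Q(2)[of "x + 2 * pi * real n"] by (simp add: algebra_simps)
  qed simp
  have "Q (x + 2 * pi * of_int k) = Q x + of_int k * period e" for x
  proof (cases "k \<ge> 0")
    case True
    then show ?thesis
      using nat[of x "nat k"] by simp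
  next
    case False
    then show ?thesis
      using nat[of "x + 2 * pi * of_int k" "nat (- k)"] by simp
  qed
  then have "Q (\<theta> 0) = Q (\<theta> 1) + of_int k * period e"
    using k by simp
  then have "of_int k * period e = 1"
    using solution_quadrature[OF Q(1) \<theta>(2) assms(4,5), of 1 0] by simp
  then show ?thesis
    by blast
qed

text \<open>Inverting the quadrature yields the angle, and the level curve supplies the radius. It
  remains to verify the full planar equation, for which the derivative of \<open>R\<close> is
  needed; the origin is an equilibrium.\<close>

lemma solution_exists:
  assumes "norm w < \<delta>" "energy w < e0"
  obtains z where "z 0 = w" "\<And>t. norm (z t) < \<delta>" "\<And>t. (z has_vector_derivative vfield (z t)) (at t)"
proof (cases "w = 0")
  case True
  have "vfield 0 = 0"
    using G_bound(3)[of 0 0 0] rho_pos by (simp add: vfield_def hgrad_def)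
  then show ?thesis
    using that[of "\<lambda>_. 0"] True delta_pos by simp
next
  case False
  define e where "e = energy w"
  have w: "w = of_real (norm w) * cis (Arg w)"
    using rcis_cmod_Arg[of w] by (simp add: rcis_def)
  have "0 < (norm w)\<^sup>2"
    using False by simp
  then have e: "0 < e" "e < e0"
    using energy_bounds(1)[of w] assms unfolding e_def by linarith+
  have R0: "R e (Arg w) = norm w"
    using False assms e w energy_polar[of "norm w" "Arg w"] by (intro R_eqI) (auto simp: e_def)
  obtain Q where Q: "\<And>x. (Q has_real_derivative q e x / pi) (at x)" "bij Q"
    "\<And>y. (inv Q has_real_derivative pi / q e (inv Q y)) (at y)"
    by (rule quadrature[OF e]) (rule that)
  define \<theta> where "\<theta> t = inv Q (Q (Arg w) - t)" for t
  have \<theta>: "(\<theta> has_real_derivative - pi / q e (\<theta> t)) (at t)" for t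
  proof -
    have "((\<lambda>t. inv Q (Q (Arg w) - t)) has_real_derivative pi / q e (inv Q (Q (Arg w) - t)) * (0 - 1)) (at t)"
      by (intro DERIV_chain2[OF Q(3)] DERIV_diff DERIV_const DERIV_ident)
    then show ?thesis
      by (simp add: \<theta>_def[abs_def])
  qed
  define z where "z t = of_real (R e (\<theta> t)) * cis (\<theta> t)" for t
  show ?thesis
  proof (rule that[of z])
    show "z 0 = w"
      using w R0 Q(2) by (simp add: z_def \<theta>_def bij_is_inj)
    show "norm (z t) < \<delta>" for t
      using R(1,2)[OF e, of "\<theta> t"] by (simp add: z_def norm_mult)
    show "(z has_vector_derivative vfield (z t)) (at t)" for t
    proof -
      let ?r = "R e (\<theta> t)" and ?u = "cis (\<theta> t)"
      \<comment> \<open>The real part of \<open>g\<close> is half of \<open>p'\<close> and governs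
        the angle; its imaginary part governs the radius. The two velocity components recombine to
        \<open>- (2 * pi * \<i>) * (cis (\<theta> t) * g)\<close>.\<close>
      define g where "g = cis (- \<theta> t) * hgrad (of_real ?r * ?u)"
      have r: "?r > 0" "?r < \<delta>"
        using R(1,2)[OF e] by auto
      have p': "p' ?r (\<theta> t) = 2 * Re g"
        using P'_real[of ?r "\<theta> t"] r delta_less_rho by (simp add: p'_def g_def)
      have Re_g: "Re g > 0"
        using p'_pos[OF r, of "\<theta> t"] p' by simp
      have q: "q e (\<theta> t) = ?r / (2 * Re g)"
        by (simp add: q_def p')
      have dR: "((\<lambda>t. R e (\<theta> t)) has_real_derivative
          - (2 * ?r * Im g) / (2 * Re g) * (- pi / q e (\<theta> t))) (at t)"
        using DERIV_chain2[OF R_has_derivative[OF e, of "\<theta> t"] \<theta>] unfolding g_def[symmetric] p' .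
      have "((\<lambda>t. of_real (R e (\<theta> t)) :: complex) has_derivative
          (\<lambda>h. of_real (- (2 * ?r * Im g) / (2 * Re g) * (- pi / q e (\<theta> t)) * h))) (at t)"
        using has_derivative_of_real[OF dR[unfolded has_field_derivative_def]] .
      moreover have "((\<lambda>t. cis (\<theta> t)) has_derivative (\<lambda>h. (- pi / q e (\<theta> t) * h) *\<^sub>R (\<i> * ?u))) (at t)"
        using has_derivative_cis[OF \<theta>[unfolded has_field_derivative_def]] .
      ultimately have "(z has_derivative (\<lambda>h. of_real ?r * ((- pi / q e (\<theta> t) * h) *\<^sub>R (\<i> * ?u)) +
          of_real (- (2 * ?r * Im g) / (2 * Re g) * (- pi / q e (\<theta> t)) * h) * ?u)) (at t)"
        unfolding z_def[abs_def] by (rule has_derivative_mult)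
      also have "(\<lambda>h. of_real ?r * ((- pi / q e (\<theta> t) * h) *\<^sub>R (\<i> * ?u)) +
          of_real (- (2 * ?r * Im g) / (2 * Re g) * (- pi / q e (\<theta> t)) * h) * ?u) = (\<lambda>h. h *\<^sub>R vfield (z t))"
      proof
        fix h
        have v: "vfield (z t) = - (2 * pi * \<i>) * (?u * g)"
        proof -
          have "?u * g = hgrad (of_real ?r * ?u)"
            by (simp add: g_def cis_mult flip: mult.assoc)
          then show ?thesis
            by (simp add: vfield_def z_def)
        qed
        have a: "?r * (- pi / q e (\<theta> t) * h) = - 2 * pi * h * Re g"
          using r Re_g by (simp add: q)
        have b: "- (2 * ?r * Im g) / (2 * Re g) * (- pi / q e (\<theta> t)) * h = 2 * pi * h * Im g"
          using r Re_g by (simp add: q)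
        have "of_real ?r * ((- pi / q e (\<theta> t) * h) *\<^sub>R (\<i> * ?u)) = of_real (?r * (- pi / q e (\<theta> t) * h)) * (\<i> * ?u)"
          by (simp add: scaleR_conv_of_real mult_ac)
        then have "of_real ?r * ((- pi / q e (\<theta> t) * h) *\<^sub>R (\<i> * ?u)) +
            of_real (- (2 * ?r * Im g) / (2 * Re g) * (- pi / q e (\<theta> t)) * h) * ?u =
            of_real (2 * pi * h) * ?u * (- \<i> * of_real (Re g) + of_real (Im g))"
          unfolding a b by (simp add: algebra_simps)
        also have "- \<i> * of_real (Re g) + of_real (Im g) = - \<i> * g"
          by (simp add: complex_eq_iff)
        finally show "of_real ?r * ((- pi / q e (\<theta> t) * h) *\<^sub>R (\<i> * ?u)) +
            of_real (- (2 * ?r * Im g) / (2 * Re g) * (- pi / q e (\<theta> t)) * h) * ?u = h *\<^sub>R vfield (z t)"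
          unfolding v by (simp add: scaleR_conv_of_real mult_ac)
      qed
      finally show ?thesis
        by (simp add: has_vector_derivative_def)
    qed
  qed
qed

end

section \<open>Isochronous Hamiltonian systems\<close>

definition pt :: "complex \<Rightarrow> real \<times> real" where
  "pt z = (sqrt 2 * Re z, sqrt 2 * Im z)"

lemma zcoord_eq: "zcoord x y = of_real (1 / sqrt 2) * Complex x y"
  by (simp add: zcoord_def divide_inverse mult.commute)

lemma zcoord_pt: "zcoord (fst (pt z)) (snd (pt z)) = z"
  by (simp add: zcoord_eq pt_def complex_eq_iff)

lemma pt_zcoord: "pt (zcoord x y) = (x, y)"
  by (simp add: zcoord_eq pt_def)

lemma norm_pt: "norm (pt z) = sqrt 2 * norm z"
proof -
  have "norm (pt z) = sqrt (2 * ((Re z)\<^sup>2 + (Im z)\<^sup>2))"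
    by (simp add: pt_def norm_prod_def power_mult_distrib distrib_left)
  then show ?thesis
    by (simp only: real_sqrt_mult norm_complex_def)
qed

lemma norm_zcoord: "norm (zcoord x y) = norm (x, y) / sqrt 2"
  using norm_pt[of "zcoord x y"] by (simp add: pt_zcoord)

lemma continuous_on_zcoord [continuous_intros]:
  assumes "continuous_on A f" "continuous_on A k"
  shows "continuous_on A (\<lambda>x. zcoord (f x) (k x))"
proof -
  have "continuous_on A (\<lambda>x. of_real (1 / sqrt 2) * Complex (f x) (k x))"
    by (rule continuous_on_mult[OF continuous_on_const continuous_on_Complex[OF assms]])
  then show ?thesis
    by (simp add: zcoord_def divide_inverse mult.commute)
qed

text \<open>\<open>H\<close> and \<open>U\<close> are described only over the disc
  \<open>norm z < \<delta>\<close>; \<open>confined\<close> keeps the relevant solutions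
  there.\<close>

locale hamiltonian_chart = real_cubic_series +
  fixes H :: "real \<Rightarrow> real \<Rightarrow> real" and U :: "(real \<times> real) set"
  assumes chart_in_U: "norm z < \<delta> \<Longrightarrow> pt z \<in> U"
    and H_energy: "norm z < \<delta> \<Longrightarrow> H (fst (pt z)) (snd (pt z)) = 2 * pi * energy z"
begin

lemma H_eq: "norm (zcoord x y) < \<delta> \<Longrightarrow> H x y = 2 * pi * energy (zcoord x y)"
  using H_energy[of "zcoord x y"] by (simp add: pt_zcoord)

lemma H_partial_derivatives:
  assumes "norm (zcoord x y) < \<delta>"
  shows "deriv (\<lambda>y. H x y) y = sqrt 2 * Re (vfield (zcoord x y))"
    and "- deriv (\<lambda>x. H x y) x = sqrt 2 * Im (vfield (zcoord x y))"
proof -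
  let ?g = "hgrad (zcoord x y)"
  \<comment> \<open>One chain rule along coordinate lines serves both partial derivatives:
    \<open>v\<close> is \<open>\<i>\<close> for y and \<open>1\<close> for x.\<close>
  have chain: "((\<lambda>s. H (f s) (k s)) has_real_derivative 2 * pi * (2 * Re (cnj ?g * (of_real (1 / sqrt 2) * v)))) (at s)"
    if "f s = x" "k s = y" "continuous_on UNIV f" "continuous_on UNIV k"
      and d: "((\<lambda>s. Complex (f s) (k s)) has_derivative (\<lambda>h. of_real h * v)) (at s)" for f k s v
  proof -
    have "((\<lambda>s. zcoord (f s) (k s)) has_derivative (\<lambda>h. of_real (1 / sqrt 2) * (of_real h * v))) (at s)"
      unfolding zcoord_eq by (rule has_derivative_mult_right[OF d])
    then have "((\<lambda>s. energy (zcoord (f s) (k s))) has_derivative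
        (\<lambda>h. 2 * Re (cnj ?g * (of_real (1 / sqrt 2) * (of_real h * v))))) (at s)"
      by (rule has_derivative_compose) (use energy_has_derivative[OF assms] that(1,2) in simp)
    then have "((\<lambda>s. 2 * pi * energy (zcoord (f s) (k s))) has_derivative
        (\<lambda>h. 2 * pi * (2 * Re (cnj ?g * (of_real (1 / sqrt 2) * (of_real h * v)))))) (at s)"
      by (rule has_derivative_mult_right)
    moreover have "(\<lambda>h. 2 * pi * (2 * Re (cnj ?g * (of_real (1 / sqrt 2) * (of_real h * v))))) =
        (*) (2 * pi * (2 * Re (cnj ?g * (of_real (1 / sqrt 2) * v))))"
      by (rule ext) (simp add: algebra_simps)
    ultimately have "((\<lambda>s. 2 * pi * energy (zcoord (f s) (k s))) has_real_derivative
        2 * pi * (2 * Re (cnj ?g * (of_real (1 / sqrt 2) * v)))) (at s)"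
      by (simp only: has_field_derivative_def)
    \<comment> \<open>The identity of \<open>H\<close> with \<open>2 * pi * energy\<close> is only
      local, which is enough since a derivative depends on the function near the point.\<close>
    then show ?thesis
    proof (rule has_field_derivative_transform_within_open)
      show "open {s. norm (zcoord (f s) (k s)) < \<delta>}"
        by (intro open_Collect_less continuous_intros that)
      show "s \<in> {s. norm (zcoord (f s) (k s)) < \<delta>}"
        using assms that by simp
      show "2 * pi * energy (zcoord (f s) (k s)) = H (f s) (k s)"
        if "s \<in> {s. norm (zcoord (f s) (k s)) < \<delta>}" for s
        using that by (simp add: H_eq)
    qed
  qed
  have sq: "2 / sqrt 2 = sqrt 2"
    by (simp add: real_div_sqrt)
  have "((\<lambda>s. Complex x s) has_derivative (\<lambda>h. of_real h * \<i>)) (at y)"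
    unfolding Complex_eq by (auto intro!: derivative_eq_intros simp: mult.commute)
  then have "deriv (\<lambda>y. H x y) y = 2 * pi * (2 * Re (cnj ?g * (of_real (1 / sqrt 2) * \<i>)))"
    by (intro DERIV_imp_deriv chain) (auto intro!: continuous_intros)
  also have "\<dots> = 2 / sqrt 2 * (2 * pi * Im ?g)"
    by simp
  also have "\<dots> = sqrt 2 * Re (vfield (zcoord x y))"
    unfolding sq by (simp add: vfield_def)
  finally show "deriv (\<lambda>y. H x y) y = sqrt 2 * Re (vfield (zcoord x y))" .
  have "((\<lambda>s. Complex s y) has_derivative (\<lambda>h. of_real h * 1)) (at x)"
    unfolding Complex_eq by (auto intro!: derivative_eq_intros)
  then have "deriv (\<lambda>x. H x y) x = 2 * pi * (2 * Re (cnj ?g * (of_real (1 / sqrt 2) * 1)))"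
    by (intro DERIV_imp_deriv chain) (auto intro!: continuous_intros)
  also have "\<dots> = 2 / sqrt 2 * (2 * pi * Re ?g)"
    by simp
  also have "\<dots> = - (sqrt 2 * Im (vfield (zcoord x y)))"
    unfolding sq by (simp add: vfield_def)
  finally show "- deriv (\<lambda>x. H x y) x = sqrt 2 * Im (vfield (zcoord x y))"
    by simp
qed

abbreviation zcurve :: "(real \<Rightarrow> real \<times> real) \<Rightarrow> real \<Rightarrow> complex" where
  "zcurve \<gamma> t \<equiv> zcoord (fst (\<gamma> t)) (snd (\<gamma> t))"

lemma hamiltonian_solution_flow:
  assumes "hamiltonian_solution H U \<gamma>"
  shows "continuous_on UNIV (zcurve \<gamma>)"
    and "norm (zcurve \<gamma> t) < \<delta> \<Longrightarrow> (zcurve \<gamma> has_vector_derivative vfield (zcurve \<gamma> t)) (at t)"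
proof -
  have d: "((\<lambda>s. fst (\<gamma> s)) has_real_derivative deriv (\<lambda>y. H (fst (\<gamma> t)) y) (snd (\<gamma> t))) (at t)"
    "((\<lambda>s. snd (\<gamma> s)) has_real_derivative - deriv (\<lambda>x. H x (snd (\<gamma> t))) (fst (\<gamma> t))) (at t)" for t
    using assms by (auto simp: hamiltonian_solution_def)
  have "continuous_on UNIV (\<lambda>s. fst (\<gamma> s))" "continuous_on UNIV (\<lambda>s. snd (\<gamma> s))"
    using DERIV_isCont[OF d(1)] DERIV_isCont[OF d(2)] by (simp_all add: continuous_on_eq_continuous_at)
  then show "continuous_on UNIV (zcurve \<gamma>)"
    by (rule continuous_on_zcoord)
  assume n: "norm (zcurve \<gamma> t) < \<delta>"
  let ?v = "vfield (zcurve \<gamma> t)"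
  have "((\<lambda>s. fst (\<gamma> s)) has_derivative (*) (sqrt 2 * Re ?v)) (at t)"
    "((\<lambda>s. snd (\<gamma> s)) has_derivative (*) (sqrt 2 * Im ?v)) (at t)"
    using d[of t] unfolding H_partial_derivatives[OF n] by (simp_all add: has_field_derivative_def)
  then have "(zcurve \<gamma> has_derivative
      (\<lambda>h. of_real (1 / sqrt 2) * (of_real (sqrt 2 * Re ?v * h) + \<i> * of_real (sqrt 2 * Im ?v * h)))) (at t)"
    unfolding zcoord_eq Complex_eq
    by (intro has_derivative_mult_right has_derivative_add has_derivative_of_real)
  moreover have "of_real (1 / sqrt 2) * (of_real (sqrt 2 * Re ?v * h) + \<i> * of_real (sqrt 2 * Im ?v * h)) = h *\<^sub>R ?v" for h
    by (simp add: complex_eq_iff)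
  ultimately show "(zcurve \<gamma> has_vector_derivative ?v) (at t)"
    by (simp add: has_vector_derivative_def)
qed

lemma flow_hamiltonian_solution:
  assumes "\<And>t. norm (z t) < \<delta>" "\<And>t. (z has_vector_derivative vfield (z t)) (at t)"
  shows "hamiltonian_solution H U (\<lambda>t. pt (z t))"
proof -
  have d: "((\<lambda>t. sqrt 2 * Re (z t)) has_real_derivative sqrt 2 * Re (vfield (z t))) (at t)"
    "((\<lambda>t. sqrt 2 * Im (z t)) has_real_derivative sqrt 2 * Im (vfield (z t))) (at t)" for t
  proof -
    have z: "(z has_derivative (\<lambda>h. h *\<^sub>R vfield (z t))) (at t)"
      using assms(2) by (simp add: has_vector_derivative_def)
    show "((\<lambda>t. sqrt 2 * Re (z t)) has_real_derivative sqrt 2 * Re (vfield (z t))) (at t)"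
    proof -
      have "(\<lambda>h. sqrt 2 * Re (h *\<^sub>R vfield (z t))) = (*) (sqrt 2 * Re (vfield (z t)))"
        by (rule ext) simp
      then show ?thesis
        using has_derivative_mult_right[OF has_derivative_Re[OF z], of "sqrt 2"]
        by (simp only: has_field_derivative_def)
    qed
    show "((\<lambda>t. sqrt 2 * Im (z t)) has_real_derivative sqrt 2 * Im (vfield (z t))) (at t)"
    proof -
      have "(\<lambda>h. sqrt 2 * Im (h *\<^sub>R vfield (z t))) = (*) (sqrt 2 * Im (vfield (z t)))"
        by (rule ext) simp
      then show ?thesis
        using has_derivative_mult_right[OF has_derivative_Im[OF z], of "sqrt 2"]
        by (simp only: has_field_derivative_def)
    qed
  qed
  have "zcoord (sqrt 2 * Re (z t)) (sqrt 2 * Im (z t)) = z t" for t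
    using zcoord_pt[of "z t"] by (simp add: pt_def)
  then have "deriv (\<lambda>y. H (sqrt 2 * Re (z t)) y) (sqrt 2 * Im (z t)) = sqrt 2 * Re (vfield (z t))"
    "- deriv (\<lambda>x. H x (sqrt 2 * Im (z t))) (sqrt 2 * Re (z t)) = sqrt 2 * Im (vfield (z t))" for t
    using H_partial_derivatives[of "sqrt 2 * Re (z t)" "sqrt 2 * Im (z t)"] assms(1)[of t] by simp_all
  then show ?thesis
    using d chart_in_U[OF assms(1)] unfolding hamiltonian_solution_def by (simp add: pt_def)
qed

section \<open>Isochronicity and period one\<close>

lemma period_one_if_isochronous:
  assumes "locally_isochronous H U"
  shows "\<exists>\<epsilon>>0. \<epsilon> \<le> e0 \<and> (\<forall>e. 0 < e \<and> e < \<epsilon> \<longrightarrow> period e = 1)"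
proof -
  obtain V where V: "open V" "(0, 0) \<in> V"
    "\<And>p. p \<in> V \<Longrightarrow> \<exists>\<gamma>. hamiltonian_solution H U \<gamma> \<and> \<gamma> 0 = p"
    "\<And>\<gamma> t. hamiltonian_solution H U \<gamma> \<Longrightarrow> \<gamma> 0 \<in> V \<Longrightarrow> \<gamma> (t + 1) = \<gamma> t"
    using assms unfolding locally_isochronous_def by metis
  obtain r where r: "r > 0" "ball (0, 0) r \<subseteq> V"
    using V(1,2) by (auto simp: open_contains_ball)
  obtain \<epsilon> where \<epsilon>: "\<epsilon> > 0" "\<epsilon> \<le> e0" "\<And>e. 0 < e \<Longrightarrow> e < \<epsilon> \<Longrightarrow> \<bar>period e - 1\<bar> < 1 / 2"
    using period_tendsto by blast
  show ?thesis
  \<comment> \<open>\<open>pt\<close> stretches by \<open>sqrt 2\<close>, so the starting point has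
    squared norm at most \<open>16 / 7 * e\<close>; energies below \<open>r\<^sup>2 / 4\<close> keep
    this under \<open>r\<^sup>2\<close>.\<close>
  proof (intro exI[of _ "min \<epsilon> (r\<^sup>2 / 4)"] conjI allI impI)
    fix e assume "0 < e \<and> e < min \<epsilon> (r\<^sup>2 / 4)"
    then have e: "0 < e" "e < e0" "e < \<epsilon>" "e < r\<^sup>2 / 4"
      using \<epsilon>(2) by auto
    define w where "w = complex_of_real (R e 0)"
    have w: "norm w < \<delta>" "energy w = e"
      using R[OF e(1,2), of 0] energy_polar[of "R e 0" 0] by (simp_all add: w_def)
    have "(norm (pt w))\<^sup>2 < r\<^sup>2"
      using R_bounds(2)[OF e(1,2), of 0] e(1,4) by (simp add: norm_pt power_mult_distrib w_def)
    then have "norm (pt w) < r"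
      by (rule power2_less_imp_less) (use r(1) in simp)
    then have "pt w \<in> V"
      using r(2) by (auto simp: dist_norm zero_prod_def[symmetric])
    then obtain \<gamma> where \<gamma>: "hamiltonian_solution H U \<gamma>" "\<gamma> 0 = pt w"
      using V(3) by blast
    have z0: "zcurve \<gamma> 0 = w"
      by (simp add: \<gamma>(2) zcoord_pt)
    note flow = hamiltonian_solution_flow[OF \<gamma>(1)]
    have conf: "norm (zcurve \<gamma> t) < \<delta>" "energy (zcurve \<gamma> t) = e" for t
      using confined[OF flow(1) _ _ flow(2), of t] w e(2) by (simp_all add: z0)
    have "\<gamma> 1 = \<gamma> 0"
      using V(4)[OF \<gamma>(1), of 0] \<open>pt w \<in> V\<close> \<gamma>(2) by simp
    then obtain k :: int where k: "of_int k * period e = 1"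
      using return_time_multiple_of_period[of "zcurve \<gamma>", OF conf(1) flow(2)[OF conf(1)] conf(2) e(1,2)] by auto
    have T: "1 / 2 < period e" "period e < 3 / 2"
      using \<epsilon>(3)[OF e(1,3)] unfolding abs_less_iff by linarith+
    have "k = 1"
    proof -
      have "of_int k > (0 :: real)"
        using k T by (metis zero_less_mult_iff zero_less_one less_trans not_less_iff_gr_or_eq half_gt_zero)
      moreover have "of_int k < (2 :: real)"
      proof (rule ccontr)
        assume "\<not> of_int k < (2 :: real)"
        then have "2 * period e \<le> of_int k * period e"
          using T by (intro mult_right_mono) auto
        then show False
          using k T by simp
      qed
      ultimately show ?thesis
        by linarith
    qed
    then show "period e = 1"
      using k by simp
  qed (use \<epsilon> r in auto)
qed

lemma isochronous_if_period_one:
  assumes "\<And>e. 0 < e \<Longrightarrow> e < e0 \<Longrightarrow> period e = 1"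
  shows "locally_isochronous H U"
proof -
  \<comment> \<open>Within radius \<open>\<delta> / 3\<close> the energy is at most
    \<open>9 / 8 * \<delta>\<^sup>2 / 9 = \<delta>\<^sup>2 / 8\<close>, half of
    \<open>e0\<close>.\<close>
  define V where "V = {p. norm (zcoord (fst p) (snd p)) < \<delta> / 3}"
  have V: "norm (zcoord (fst p) (snd p)) < \<delta>" "energy (zcoord (fst p) (snd p)) < e0" if "p \<in> V" for p
  proof -
    have n: "norm (zcoord (fst p) (snd p)) < \<delta> / 3"
      using that by (simp add: V_def)
    then show less: "norm (zcoord (fst p) (snd p)) < \<delta>"
      using delta_pos by linarith
    have "(norm (zcoord (fst p) (snd p)))\<^sup>2 \<le> (\<delta> / 3)\<^sup>2"
      using n by (intro power_mono) auto
    moreover have "(\<delta> / 3)\<^sup>2 = \<delta>\<^sup>2 / 9" "0 < \<delta>\<^sup>2"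
      using delta_pos by (simp_all add: power_divide)
    ultimately show "energy (zcoord (fst p) (snd p)) < e0"
      using energy_bounds(2)[of "zcoord (fst p) (snd p)"] less unfolding e0_def by linarith
  qed
  have "open V"
    unfolding V_def by (intro open_Collect_less continuous_intros)
  moreover have "(0, 0) \<in> V"
    using delta_pos by (simp add: V_def norm_zcoord zero_prod_def[symmetric])
  moreover have "V \<subseteq> U"
  proof
    fix p assume "p \<in> V"
    then show "p \<in> U"
      using chart_in_U[OF V(1)] by (simp add: pt_zcoord)
  qed
  moreover have "\<exists>\<gamma>. hamiltonian_solution H U \<gamma> \<and> \<gamma> 0 = p" if p: "p \<in> V" for p
  proof -
    obtain z where z: "z 0 = zcoord (fst p) (snd p)" "\<And>t. norm (z t) < \<delta>"
      "\<And>t. (z has_vector_derivative vfield (z t)) (at t)"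
      by (rule solution_exists[OF V[OF p]]) (rule that)
    show ?thesis
      using flow_hamiltonian_solution[OF z(2,3)] z(1) by (intro exI[of _ "\<lambda>t. pt (z t)"]) (simp add: pt_zcoord)
  qed
  moreover have "\<gamma> (t + 1) = \<gamma> t" if \<gamma>: "hamiltonian_solution H U \<gamma>" "\<gamma> 0 \<in> V" for \<gamma> t
  proof -
    note flow = hamiltonian_solution_flow[OF \<gamma>(1)]
    define e where "e = energy (zcurve \<gamma> 0)"
    have conf: "norm (zcurve \<gamma> t) < \<delta>" "energy (zcurve \<gamma> t) = e" for t
      using confined[OF flow(1) V[OF \<gamma>(2)] flow(2), of t] by (simp_all add: e_def)
    have "zcurve \<gamma> (t + 1) = zcurve \<gamma> t"
    \<comment> \<open>Zero energy means rest at the origin; the polar description by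
      \<open>R e\<close> covers positive energies.\<close>
    proof (cases "e = 0")
      case True
      have "zcurve \<gamma> t = 0" for t
        using energy_bounds(1)[of "zcurve \<gamma> t"] conf[of t] True by simp
      then show ?thesis
        by simp
    next
      case False
      have "e \<ge> 0"
        using energy_bounds(1)[of "zcurve \<gamma> 0"] conf(1)[of 0] zero_le_power2[of "norm (zcurve \<gamma> 0)"]
        unfolding e_def by linarith
      then have e: "0 < e" "e < e0"
        using False V(2)[OF \<gamma>(2)] by (auto simp: e_def)
      show ?thesis
        by (rule solution_periodic[of "zcurve \<gamma>", OF conf(1) flow(2)[OF conf(1)] conf(2) e assms[OF e]])
    qed
    then show ?thesis
      using pt_zcoord[of "fst (\<gamma> t)" "snd (\<gamma> t)"] pt_zcoord[of "fst (\<gamma> (t + 1))" "snd (\<gamma> (t + 1))"] by simp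
  qed
  ultimately show ?thesis
    unfolding locally_isochronous_def by blast
qed

lemma isochronous_iff_mean_coeff: "locally_isochronous H U \<longleftrightarrow> (\<forall>d\<ge>1. mean_coeff d = 0)"
proof
  assume "locally_isochronous H U"
  then show "\<forall>d\<ge>1. mean_coeff d = 0"
    using period_one_if_isochronous period_constant_iff by metis
next
  assume "\<forall>d\<ge>1. mean_coeff d = 0"
  then have "\<forall>e. 0 < e \<and> e < e0 \<longrightarrow> period e = 1"
    using period_constant_iff[of e0] e0_pos by simp
  then show "locally_isochronous H U"
    by (intro isochronous_if_period_one) simp
qed

end

theorem theorem1:
  fixes H Hs :: "real \<Rightarrow> real \<Rightarrow> real"
    and h :: "nat \<times> nat \<Rightarrow> complex"
    and U :: "(real \<times> real) set"
  assumes "open U" and "(0, 0) \<in> U"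
    and "\<And>x y. (x, y) \<in> U \<Longrightarrow> H x y = pi * (x\<^sup>2 + y\<^sup>2) + Hs x y"
    and "(\<lambda>(x, y). Hs x y) \<in> O[nhds (0, 0)](\<lambda>(x, y). (\<bar>x\<bar> + \<bar>y\<bar>) ^ 3)"
    and "\<And>x y. (x, y) \<in> U \<Longrightarrow>
           ((\<lambda>\<beta>. h \<beta> * zcoord x y ^ fst \<beta> * cnj (zcoord x y) ^ snd \<beta>)
              has_sum complex_of_real (Hs x y)) {\<beta>. fst \<beta> + snd \<beta> \<ge> 3}"
  shows "locally_isochronous H U \<longleftrightarrow>
    (\<forall>d\<ge>1. (\<Sum>s = 1..2 * d.
        (-1) ^ (s - 1) * fact (d + s) / (fact s * fact (d + 1)) * Sigma_coeff h d s) = 0)"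
proof -
  \<comment> \<open>Division by \<open>2 * pi\<close> normalizes the quadratic part to
    \<open>z * cnj z\<close>; in a product of \<open>k\<close> coefficients it produces the factor
    \<open>(2 * pi) ^ k\<close> of \<open>Sigma_coeff\<close>.\<close>
  define g where "g \<beta> = h \<beta> / (2 * pi)" for \<beta>
  obtain r where r: "r > 0" "ball (0, 0) r \<subseteq> U"
    using assms(1,2) by (auto simp: open_contains_ball)
  \<comment> \<open>Halving compensates for the stretching of \<open>pt\<close> by
    \<open>sqrt 2 < 2\<close>.\<close>
  define \<rho> where "\<rho> = r / 2"
  have \<rho>: "\<rho> > 0"
    using r by (simp add: \<rho>_def)
  have sqrt2: "sqrt 2 < 2"
    by (rule real_less_lsqrt) auto
  have in_U: "pt z \<in> U" if "norm z \<le> \<rho>" for z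
  proof -
    have "norm (pt z) \<le> sqrt 2 * \<rho>"
      unfolding norm_pt using that by (intro mult_left_mono) auto
    also have "\<dots> < 2 * \<rho>"
      using sqrt2 \<rho> by (intro mult_strict_right_mono) auto
    finally have "pt z \<in> ball (0, 0) r"
      by (simp add: dist_norm zero_prod_def[symmetric] \<rho>_def)
    then show ?thesis
      using r(2) by blast
  qed
  have g_sum: "((\<lambda>\<beta>. g \<beta> * z ^ fst \<beta> * cnj z ^ snd \<beta>) has_sum
      of_real (Hs (fst (pt z)) (snd (pt z)) / (2 * pi))) {\<beta>. fst \<beta> + snd \<beta> \<ge> 3}"
    if "norm z \<le> \<rho>" for z
  proof -
    have "((\<lambda>\<beta>. h \<beta> * z ^ fst \<beta> * cnj z ^ snd \<beta>) has_sum
        of_real (Hs (fst (pt z)) (snd (pt z)))) {\<beta>. fst \<beta> + snd \<beta> \<ge> 3}"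
      using assms(5)[of "fst (pt z)" "snd (pt z)"] in_U[OF that] by (simp add: zcoord_pt)
    from has_sum_cmult_right[OF this, of "1 / (2 * of_real pi)"] show ?thesis
      by (simp add: g_def mult_ac)
  qed
  interpret cubic_series g \<rho>
  proof
    \<comment> \<open>At the real point \<open>z = \<rho>\<close> both variables equal \<rho>.
      Convergence there, being unordered, is the absolute convergence on the bidisc that extends
      \<open>G\<close> to independent z and w.\<close>
    have "(\<lambda>\<beta>. g \<beta> * of_real \<rho> ^ fst \<beta> * of_real \<rho> ^ snd \<beta>) summable_on {\<beta>. fst \<beta> + snd \<beta> \<ge> 3}"
      using has_sum_imp_summable[OF g_sum[of "of_real \<rho>"]] \<rho> by simp
    then have "(\<lambda>\<beta>. norm (g \<beta> * of_real \<rho> ^ fst \<beta> * of_real \<rho> ^ snd \<beta>)) summable_on {\<beta>. fst \<beta> + snd \<beta> \<ge> 3}"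
      by (simp only: summable_on_iff_abs_summable_on_complex)
    then show "(\<lambda>\<beta>. norm (g \<beta>) * \<rho> ^ (fst \<beta> + snd \<beta>)) summable_on {\<beta>. fst \<beta> + snd \<beta> \<ge> 3}"
      using \<rho> by (simp add: norm_mult norm_power power_add mult.assoc)
  qed (rule \<rho>)
  \<comment> \<open>On the real plane \<open>G\<close> and \<open>Hs / (2 * pi)\<close> are sums of
    the same series, so \<open>G\<close> inherits real values from \<open>Hs\<close>.\<close>
  have G_eq: "G z (cnj z) = of_real (Hs (fst (pt z)) (snd (pt z)) / (2 * pi))" if "norm z \<le> \<rho> / 2" for z
    using that \<rho> by (intro has_sum_unique[OF G_has_sum g_sum]) auto
  interpret real_cubic_series g \<rho>
    by unfold_locales (simp add: G_eq)
  interpret hamiltonian_chart g \<rho> H U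
  proof
    fix z :: complex assume n: "norm z < \<delta>"
    then have z: "norm z \<le> \<rho> / 2" "norm z \<le> \<rho>"
      using delta_less_rho \<rho> by auto
    show "pt z \<in> U"
      by (rule in_U[OF z(2)])
    have "pi * ((fst (pt z))\<^sup>2 + (snd (pt z))\<^sup>2) = 2 * pi * Re (z * cnj z)"
      by (simp add: pt_def power_mult_distrib power2_eq_square algebra_simps)
    then show "H (fst (pt z)) (snd (pt z)) = 2 * pi * energy z"
      using assms(3)[of "fst (pt z)" "snd (pt z)"] in_U[OF z(2)]
      by (simp add: energy_def G_eq[OF z(1)] algebra_simps)
  qed
  have "tuple_sum d s = Sigma_coeff h d s" for d s
  proof -
    have "prod_list (map g bs) = prod_list (map h bs) / of_real ((2 * pi) ^ length bs)" for bs
      by (induction bs) (simp_all add: g_def)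
    then have "tuple_sum d s = (\<Sum>bs\<in>index_tuples d s. prod_list (map h bs) / of_real ((2 * pi) ^ s))"
      unfolding tuple_sum_def by (intro sum.cong) (auto simp: index_tuples_def)
    then show ?thesis
      by (simp add: Sigma_coeff_def sum_divide_distrib)
  qed
  then have "mean_coeff d = 0 \<longleftrightarrow> (\<Sum>s = 1..2 * d.
      (-1) ^ (s - 1) * fact (d + s) / (fact s * fact (d + 1)) * Sigma_coeff h d s) = 0" if "d \<ge> 1" for d
    using mean_coeff_pos_degree[OF that] by (simp del: of_nat_Suc of_nat_add fact_Suc)
  then show ?thesis
    unfolding isochronous_iff_mean_coeff by simp
qed

end
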